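(* Let $p\geq 1$ be an integer. For any positive real numbers $t_1,t_2,\ldots,t_p$ and any $k\in\mathbb{N}=\{1,2,\ldots\}$, the $k$-th moment of the free multiplicative convolution of the Marchenko-Pastur laws $\varrho_{t_1},\ldots,\varrho_{t_p}$ is $$m_k(\varrho_{t_1}\boxtimes\varrho_{t_2}\boxtimes\cdots\boxtimes\varrho_{t_p})=F_k(t_1,t_2,\ldots,t_p).$$
   Context: For $t>0$ the Marchenko-Pastur law with shape parameter $t$ is the probability measure on $\mathbb{R}$ $$\varrho_t=\max\{1-t,0\}\,\delta_0+\frac{\sqrt{(x-a)(b-x)}}{2\pi x}\,\mathbf{1}_{[a,b]}(x)\,dx,\qquad a=(1-\sqrt t)^2,\ b=(1+\sqrt t)^2.$$ $\boxtimes$ denotes the free multiplicative convolution of probability measures on $[0,\infty)$ (in the sense of free probability), and $m_k(\mu)=\int x^k\,d\mu(x)$ is the $k$-th moment of $\mu$. The multivariate Fuss-Narayana polynomials are $$F_k(t_1,\ldots,t_p)=\sum_{\substack{j_0,\ldots,j_p\in\{1,\ldots,k\}\\ j_0+\cdots+j_p=pk+1}}\frac{1}{k}\binom{k}{j_0}\binom{k}{j_1}\cdots\binom{k}{j_p}\,t_1^{j_1}t_2^{j_2}\cdots t_p^{j_p}.$$ *)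

theory Defs
  imports "HOL-Probability.Probability" "HOL-Library.Poly_Mapping"
begin

section \<open>Noncommutative probability spaces and freeness\<close>

locale complex_algebra = vector_space scale
  for scale :: "complex \<Rightarrow> 'a::ring_1 \<Rightarrow> 'a" +
  assumes scale_mult_left: "scale c x * y = scale c (x * y)"
    and scale_mult_right: "x * scale c y = scale c (x * y)"
begin

text \<open>A unital complex algebra together with a functional satisfying the following predicate is a
  noncommutative probability space.\<close>

definition unital_functional :: "('a \<Rightarrow> complex) \<Rightarrow> bool" where
  "unital_functional \<phi> \<longleftrightarrow> Vector_Spaces.linear scale (*) \<phi> \<and> \<phi> 1 = 1"

definition subalgebra_gen :: "'a \<Rightarrow> 'a set" where
  "subalgebra_gen x = span {x ^ n |n. True}"

text \<open>Freeness of the variables \<open>x i\<close>, \<open>i \<in> I\<close>: any product of centred elements of the unital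
  subalgebras they generate, in which neighbouring factors come from different subalgebras, is
  centred. A product is encoded as a nonempty list of pairs (index, factor).\<close>

definition free_vars :: "('a \<Rightarrow> complex) \<Rightarrow> ('i \<Rightarrow> 'a) \<Rightarrow> 'i set \<Rightarrow> bool" where
  "free_vars \<phi> x I \<longleftrightarrow>
     (\<forall>as. as \<noteq> [] \<and> (\<forall>(i, a) \<in> set as. i \<in> I \<and> a \<in> subalgebra_gen (x i) \<and> \<phi> a = 0) \<and>
           distinct_adj (map fst as) \<longrightarrow> \<phi> (prod_list (map snd as)) = 0)"

end

definition moment :: "nat \<Rightarrow> real measure \<Rightarrow> real" where
  "moment k \<mu> = (\<integral>x. x ^ k \<partial>\<mu>)"

definition compact_nonneg_prob :: "real measure \<Rightarrow> bool" where
  "compact_nonneg_prob \<mu> \<longleftrightarrow> prob_space \<mu> \<and> sets \<mu> = sets borel \<and> (\<exists>R. AE x in \<mu>. 0 \<le> x \<and> x \<le> R)"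

definition has_law :: "('a::ring_1 \<Rightarrow> complex) \<Rightarrow> 'a \<Rightarrow> real measure \<Rightarrow> bool" where
  "has_law \<phi> x \<mu> \<longleftrightarrow> (\<forall>n. \<phi> (x ^ n) = complex_of_real (moment n \<mu>))"


section \<open>The algebra of noncommutative polynomials\<close>

text \<open>Words are written additively because \<open>Poly_Mapping\<close> builds monoid algebras over additive
  monoids: \<open>'v word \<Rightarrow>\<^sub>0 complex\<close> is the free unital complex algebra over \<open>'v\<close>.\<close>

datatype 'v word = Word (letters: "'v list")

instantiation word :: (type) monoid_add
begin

definition zero_word :: "'a word" where
  "0 = Word []"

definition plus_word :: "'a word \<Rightarrow> 'a word \<Rightarrow> 'a word" where
  "u + v = Word (letters u @ letters v)"

instance
  by standard (simp_all add: zero_word_def plus_word_def)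

end

type_synonym 'v nc_poly = "'v word \<Rightarrow>\<^sub>0 complex"

definition nc_var :: "'v \<Rightarrow> 'v nc_poly" where
  "nc_var v = Poly_Mapping.single (Word [v]) 1"

definition nc_scale :: "complex \<Rightarrow> 'v nc_poly \<Rightarrow> 'v nc_poly" where
  "nc_scale c p = Poly_Mapping.single 0 c * p"

lemma nc_scalar_commute: "Poly_Mapping.single 0 c * p = p * Poly_Mapping.single 0 (c::complex)"
  for p :: "'v nc_poly"
proof (induction p rule: update_induct)
  case const
  show ?case by simp
next
  case (update f w b)
  then have "Poly_Mapping.update w b f = f + Poly_Mapping.single w b"
    by (intro poly_mapping_eqI)
      (auto simp: lookup_update lookup_add lookup_single when_def in_keys_iff)
  moreover have "Poly_Mapping.single 0 c * Poly_Mapping.single w b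
      = Poly_Mapping.single w b * Poly_Mapping.single 0 c"
    by (simp add: mult_single mult.commute)
  ultimately show ?case
    using update by (simp only: distrib_left distrib_right)
qed

interpretation nc_poly: complex_algebra "nc_scale :: complex \<Rightarrow> 'v nc_poly \<Rightarrow> 'v nc_poly"
proof
  fix a b :: complex and x y :: "'v nc_poly"
  show "nc_scale a (x + y) = nc_scale a x + nc_scale a y"
    by (simp add: nc_scale_def distrib_left)
  show "nc_scale (a + b) x = nc_scale a x + nc_scale b x"
    by (simp add: nc_scale_def single_add distrib_right)
  show "nc_scale a (nc_scale b x) = nc_scale (a * b) x"
    by (simp add: nc_scale_def mult_single flip: mult.assoc)
  show "nc_scale 1 x = x"
    by (simp add: nc_scale_def)
  show "nc_scale a x * y = nc_scale a (x * y)"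
    by (simp add: nc_scale_def mult.assoc)
  show "x * nc_scale a y = nc_scale a (x * y)"
    by (metis nc_scale_def mult.assoc nc_scalar_commute)
qed


section \<open>Free multiplicative convolution\<close>

text \<open>For compactly supported \<open>\<mu>\<close> and \<open>\<nu>\<close> on the nonnegative half-line, \<open>\<mu> \<boxtimes> \<nu>\<close> is the law of the
  product of two free variables with laws \<open>\<mu>\<close> and \<open>\<nu>\<close>. Freeness and the laws only involve the joint
  distribution of the two variables, which is a functional on the noncommutative polynomials in two
  indeterminates; hence nothing is lost by taking these indeterminates, \<open>nc_var False\<close> and
  \<open>nc_var True\<close>, as the two variables. Realising the variables by free operators \<open>x, y \<ge> 0\<close> in a
  C*-probability space, the moments of \<open>x y\<close> are those of the nonnegative operator
  \<open>sqrt x y sqrt x\<close>, because the functional is tracial on the algebra generated by \<open>x\<close> and \<open>y\<close>.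

  The value of \<open>\<mu> \<boxtimes> \<nu>\<close> carries no meaning if \<open>\<mu>\<close> or \<open>\<nu>\<close> is not of the above kind.\<close>

definition free_mult_conv :: "real measure \<Rightarrow> real measure \<Rightarrow> real measure" (infixl "\<boxtimes>" 70) where
  "\<mu> \<boxtimes> \<nu> = (THE \<kappa>. compact_nonneg_prob \<kappa> \<and>
     (\<exists>\<phi> :: bool nc_poly \<Rightarrow> complex.
        nc_poly.unital_functional \<phi> \<and> nc_poly.free_vars \<phi> nc_var UNIV \<and>
        has_law \<phi> (nc_var False) \<mu> \<and> has_law \<phi> (nc_var True) \<nu> \<and>
        has_law \<phi> (nc_var False * nc_var True) \<kappa>))"


section \<open>Marchenko-Pastur laws and Fuss-Narayana polynomials\<close>

definition mp_density :: "real \<Rightarrow> real \<Rightarrow> real" where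
  "mp_density t x =
     (let a = (1 - sqrt t)\<^sup>2; b = (1 + sqrt t)\<^sup>2
      in sqrt ((x - a) * (b - x)) / (2 * pi * x) * indicator {a..b} x)"

definition marchenko_pastur :: "real \<Rightarrow> real measure" where
  "marchenko_pastur t = measure_of UNIV (sets borel)
     (\<lambda>A. ennreal (max (1 - t) 0) * emeasure (return borel 0) A
        + emeasure (density lborel (\<lambda>x. ennreal (mp_density t x))) A)"

lemma sets_marchenko_pastur [simp]: "sets (marchenko_pastur t) = sets borel"
  using sets.sigma_sets_eq[of "borel :: real measure"] by (simp add: marchenko_pastur_def)

lemma emeasure_marchenko_pastur:
  assumes "A \<in> sets borel"
  shows "emeasure (marchenko_pastur t) A =
    ennreal (max (1 - t) 0) * indicator A 0 + (\<integral>\<^sup>+x\<in>A. ennreal (mp_density t x) \<partial>lborel)"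
proof -
  have [measurable]: "mp_density t \<in> borel_measurable borel"
    unfolding mp_density_def Let_def by measurable
  let ?d = "density lborel (\<lambda>x. ennreal (mp_density t x))"
  let ?m = "\<lambda>A. ennreal (max (1 - t) 0) * emeasure (return borel 0) A + emeasure ?d A"
  have "emeasure (marchenko_pastur t) A = ?m A"
    unfolding marchenko_pastur_def
  proof (rule emeasure_measure_of_sigma)
    show "sigma_algebra UNIV (sets (borel :: real measure))"
      by (metis sets.sigma_algebra_axioms space_borel)
    show "positive (sets borel) ?m"
      by (simp add: positive_def)
    show "countably_additive (sets borel) ?m"
    proof (rule countably_additiveI)
      fix B :: "nat \<Rightarrow> real set"
      assume B: "range B \<subseteq> sets borel" "disjoint_family B"
      have "suminf (\<lambda>i. ?m (B i)) =
          ennreal (max (1 - t) 0) * suminf (\<lambda>i. emeasure (return borel 0) (B i)) + suminf (\<lambda>i. emeasure ?d (B i))"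
        by (simp add: suminf_add[symmetric])
      also have "\<dots> = ?m (\<Union>(range B))"
        using B by (simp add: suminf_emeasure del: emeasure_return)
      finally show "suminf (\<lambda>i. ?m (B i)) = ?m (\<Union>(range B))" .
    qed
  qed (use assms in auto)
  also have "\<dots> = ennreal (max (1 - t) 0) * indicator A 0 + (\<integral>\<^sup>+x\<in>A. ennreal (mp_density t x) \<partial>lborel)"
    using assms by (simp add: emeasure_density)
  finally show ?thesis .
qed

definition fuss_narayana :: "nat \<Rightarrow> nat \<Rightarrow> (nat \<Rightarrow> real) \<Rightarrow> real" where
  "fuss_narayana p k t =
     (\<Sum>j \<in> {j \<in> {0..p} \<rightarrow>\<^sub>E {1..k}. (\<Sum>i=0..p. j i) = p * k + 1}.
        1 / real k * (\<Prod>i=0..p. real (k choose j i)) * (\<Prod>i=1..p. t i ^ j i))"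

end

theory Submission
  imports Defs
begin

text \<open>Let \<open>M\<close> be the power series without constant term that solves
\<open>M = z (1 + M) (t\<^sub>1 + M) \<cdots> (t\<^sub>p + M)\<close>. Lagrange inversion expresses its \<open>k\<close>-th coefficient
by the coefficient of \<open>w\<^bsup>k-1\<^esup>\<close> in \<open>((1 + w) (t\<^sub>1 + w) \<cdots> (t\<^sub>p + w))\<^sup>k\<close>, and expanding this
product by the binomial theorem gives \<open>F\<^sub>k(t\<^sub>1, \<dots>, t\<^sub>p)\<close> (lemma \<open>mp_series_nth\<close>). It remains to see
that \<open>1 + M\<close> is the moment generating function of the \<open>p\<close>-fold convolution; in other words that the
S-transform of a Marchenko-Pastur law is \<open>1 / (t + w)\<close> and that S-transforms multiply. The proof
is an induction on \<open>p\<close>.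

For \<open>p = 1\<close> the substitution \<open>x = 1 + t - 2 sqrt t cos \<theta>\<close> turns the moments of the
Marchenko-Pastur law into trigonometric integrals, in which orthogonality of the cosines picks out
coefficients of \<open>M\<close> (\<open>marchenko_pastur_moments\<close>).

In the induction step the convolution is given by a definite description, so its meaning rests on
four facts.

\<^item> Freeness determines the moments of the product (\<open>free_product_moment_series\<close>). Haagerup's
  argument for the multiplicativity of the S-transform works verbatim with formal power series
  over the algebra: if \<open>a = 1 / (1 - u x)\<close> and \<open>b = 1 / (1 - v y)\<close> have the same expectation \<open>1 + w\<close>,
  then \<open>w (1 - z x y)\<close> factors through \<open>w (1 + w) - a\<^sub>0 b\<^sub>0\<close> with the centred elements \<open>a\<^sub>0, b\<^sub>0\<close>, where
  \<open>u v (1 + w) = z w\<close>, and the alternating products of \<open>a\<^sub>0\<close> and \<open>b\<^sub>0\<close> have expectation zero.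

\<^item> Free variables with prescribed moments exist (\<open>free_functional\<close>): the vacuum functional of the
  left regular representation on the algebraic free product.

\<^item> The resulting moments are those of some law on a bounded interval (\<open>mp_series_moment_measure\<close>).
  They are the vacuum moments of \<open>S\<^sup>* S\<close>, where \<open>S\<close> is an explicit product of \<open>p\<close> bounded operators,
  each of which pushes a letter on a stack or pops one. Positivity and boundedness of \<open>S\<^sup>* S\<close>
  are exactly what Hausdorff's moment problem asks for; its solution is obtained from
  Bernstein's discrete measures and Helly's selection theorem.

\<^item> This law is unique, since compactly supported laws are determined by their moments
  (\<open>compact_nonneg_prob_determined_by_moments\<close>).\<close>


section \<open>Lagrange inversion and the Fuss-Narayana polynomials\<close>

text \<open>The solution of \<open>f = z P(f)\<close> without constant term, as the compositional inverse of \<open>w / P(w)\<close>.\<close>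

definition lagrange_series :: "'a::field fps \<Rightarrow> 'a fps" where
  "lagrange_series P = fps_inv (fps_X * inverse P)"

lemma lagrange_series_inverses:
  fixes P :: "'a::field fps"
  assumes "fps_nth P 0 \<noteq> 0"
  defines "a \<equiv> fps_X * inverse P"
  shows "fps_nth (lagrange_series P) 0 = 0" "lagrange_series P oo a = fps_X" "a oo lagrange_series P = fps_X"
    "fps_nth a 0 = 0"
proof -
  have a: "fps_nth a 0 = 0" "fps_nth a 1 \<noteq> 0"
    using assms by (simp_all add: a_def)
  show "fps_nth a 0 = 0" by (fact a)
  show "fps_nth (lagrange_series P) 0 = 0"
    by (simp add: lagrange_series_def fps_inv_def)
  show "lagrange_series P oo a = fps_X" "a oo lagrange_series P = fps_X"
    using fps_inv[OF a] fps_inv_right[OF a] by (simp_all add: lagrange_series_def a_def)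
qed

lemma lagrange_series_fixpoint:
  fixes P :: "'a::field fps"
  assumes "fps_nth P 0 \<noteq> 0"
  shows "lagrange_series P = fps_X * (P oo lagrange_series P)"
proof -
  let ?M = "lagrange_series P"
  note L = lagrange_series_inverses[OF assms]
  have "fps_X * inverse P * P = fps_X"
    using assms by (simp add: mult.assoc inverse_mult_eq_1)
  then have "((fps_X * inverse P) oo ?M) * (P oo ?M) = fps_X oo ?M"
    by (metis L(1) fps_compose_mult_distrib)
  then show ?thesis
    using L by simp
qed

text \<open>The parameter may itself be a power series \<open>u\<close>: in this form the lemma identifies a series as the
composition of a known generating function with \<open>u\<close>, which is how the arguments of the two resolvents
of a free pair are found.\<close>

lemma lagrange_series_unique:
  fixes P :: "'a::field fps"
  assumes "fps_nth P 0 \<noteq> 0" "fps_nth f 0 = 0" "f = u * (P oo f)"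
  shows "f = lagrange_series P oo u"
proof -
  let ?a = "fps_X * inverse P"
  note L = lagrange_series_inverses[OF assms(1)]
  have "(?a oo f) * (P oo f) = u * (P oo f)"
  proof -
    have "?a * P = fps_X"
      using assms by (simp add: mult.assoc inverse_mult_eq_1)
    then have "(?a oo f) * (P oo f) = fps_X oo f"
      by (metis assms(2) fps_compose_mult_distrib)
    then show ?thesis
      using assms by simp
  qed
  moreover have "P oo f \<noteq> 0"
    using assms by (metis fps_compose_nth_0 fps_zero_nth)
  ultimately have "?a oo f = u" by simp
  then have "lagrange_series P oo u = (lagrange_series P oo ?a) oo f"
    using fps_compose_assoc[OF assms(2) L(4), of "lagrange_series P"] by simp
  also have "\<dots> = f"
    using L assms by simp
  finally show ?thesis by simp
qed

lemma fps_compose_mult_nth: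
  fixes f g a :: "'a::comm_ring_1 fps"
  assumes "fps_nth a 0 = 0"
  shows "fps_nth ((f oo a) * g) m = (\<Sum>i\<le>m. fps_nth f i * fps_nth (a ^ i * g) m)"
proof -
  have c: "fps_nth (f oo a) j = (\<Sum>i\<le>m. fps_nth f i * fps_nth (a ^ i) j)" if "j \<le> m" for j
    unfolding fps_compose_nth
    using that startsby_zero_power_prefix[OF assms]
    by (intro sum.mono_neutral_left) auto
  have "fps_nth ((f oo a) * g) m = (\<Sum>j=0..m. (\<Sum>i\<le>m. fps_nth f i * fps_nth (a ^ i) j) * fps_nth g (m - j))"
    by (simp add: fps_mult_nth c)
  also have "\<dots> = (\<Sum>i\<le>m. fps_nth f i * fps_nth (a ^ i * g) m)"
    unfolding sum_distrib_right fps_mult_nth sum_distrib_left mult.assoc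
    by (rule sum.swap)
  finally show ?thesis .
qed

text \<open>Multiplied by \<open>z\<^bsup>-r-1\<^esup>\<close>, the series is the derivative of a constant multiple of \<open>(P / z)\<^sup>r\<close> if \<open>r > 0\<close>, and
derivatives have no residue. If \<open>r = 0\<close> it is the logarithmic derivative of \<open>z / P\<close>, whose residue is the
order of the zero at the origin.\<close>

lemma fps_nth_power_residue:
  fixes P :: "'a::field_char_0 fps"
  assumes "fps_nth P 0 \<noteq> 0"
  shows "fps_nth (P ^ r * (1 - fps_X * fps_deriv P * inverse P)) r = (if r = 0 then 1 else 0)"
proof (cases r)
  case (Suc n)
  have "P ^ r * (1 - fps_X * fps_deriv P * inverse P)
      = P ^ r - fps_X * (P ^ n * fps_deriv P) * (P * inverse P)"
    by (simp add: Suc algebra_simps)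
  also have "\<dots> = P ^ r - fps_X * (P ^ n * fps_deriv P)"
    using inverse_mult_eq_1'[OF assms] by simp
  finally have *: "fps_nth (P ^ r * (1 - fps_X * fps_deriv P * inverse P)) r
      = fps_nth (P ^ r) r - fps_nth (P ^ n * fps_deriv P) n"
    by (simp add: Suc)
  have "of_nat r * fps_nth (P ^ n * fps_deriv P) n = fps_nth (fps_deriv (P ^ r)) n"
    unfolding fps_deriv_power Suc 
    by (metis (no_types, lifting) Suc diff_Suc_1 fps_mult_left_const_nth fps_of_nat mult.assoc mult.commute)
  also have "\<dots> = of_nat r * fps_nth (P ^ r) r"
    by (simp add: Suc del: power_Suc)
  finally have "fps_nth (P ^ n * fps_deriv P) n = fps_nth (P ^ r) r"
    by (simp add: Suc del: of_nat_Suc)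
  with * show ?thesis by (simp add: Suc)
qed simp

text \<open>With \<open>a = z / P\<close>, differentiating \<open>M(a(z)) = z\<close> gives \<open>M'(a) a' = 1\<close>. Multiplied by \<open>P\<^sup>n\<close> and expanded
in powers of \<open>a\<close>, the coefficient of \<open>z\<^bsup>n-1\<^esup>\<close> on the left receives a contribution from a single term of
\<open>M'\<close> only, by the residue computation.\<close>

lemma lagrange_inversion:
  fixes P :: "'a::field_char_0 fps"
  assumes P: "fps_nth P 0 \<noteq> 0" and n: "n \<ge> 1"
  shows "fps_nth (lagrange_series P) n = fps_nth (P ^ n) (n - 1) / of_nat n"
proof -
  let ?M = "lagrange_series P"
  define a where "a = fps_X * inverse P"
  note L = lagrange_series_inverses[OF P, folded a_def]
  have da: "fps_deriv a = inverse P * (1 - fps_X * fps_deriv P * inverse P)"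
    by (simp add: a_def fps_inverse_deriv[OF P] algebra_simps power2_eq_square)
  have "(fps_deriv ?M oo a) * fps_deriv a = 1"
    using L by (metis fps_compose_deriv fps_deriv_fps_X)
  then have "fps_nth (P ^ n) (n - 1) = fps_nth ((fps_deriv ?M oo a) * (fps_deriv a * P ^ n)) (n - 1)"
    by (simp flip: mult.assoc)
  also have "\<dots> = (\<Sum>i\<le>n-1. fps_nth (fps_deriv ?M) i * fps_nth (a ^ i * (fps_deriv a * P ^ n)) (n-1))"
    by (rule fps_compose_mult_nth) (fact L)
  also have "\<dots> = (\<Sum>i\<le>n-1. fps_nth (fps_deriv ?M) i * (if i = n - 1 then 1 else 0))"
  proof (intro sum.cong refl arg_cong2[where f = "(*)"])
    fix i assume i: "i \<in> {..n-1}"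
    define r where "r = n - 1 - i"
    have n_eq: "n = r + i + 1" using i n by (simp add: r_def)
    have "a ^ i * (fps_deriv a * P ^ n)
        = fps_X ^ i * ((P * inverse P) ^ (i + 1) * (P ^ r * (1 - fps_X * fps_deriv P * inverse P)))"
      unfolding da unfolding a_def by (simp add: n_eq power_add power_mult_distrib mult_ac)
    also have "P * inverse P = 1"
      by (rule inverse_mult_eq_1'[OF P])
    finally have "fps_nth (a ^ i * (fps_deriv a * P ^ n)) (n-1)
        = fps_nth (P ^ r * (1 - fps_X * fps_deriv P * inverse P)) r"
      using n_eq by (simp add: fps_X_power_mult_nth)
    then show "fps_nth (a ^ i * (fps_deriv a * P ^ n)) (n-1) = (if i = n - 1 then 1 else 0)"
      using fps_nth_power_residue[OF P, of r] n_eq by auto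
  qed
  also have "\<dots> = of_nat n * fps_nth ?M n"
    using n by (cases n) (simp_all add: mult_delta_right)
  finally show ?thesis
    using n by (simp add: field_simps)
qed


definition mp_symbol :: "nat \<Rightarrow> (nat \<Rightarrow> 'a::field) \<Rightarrow> 'a fps" where
  "mp_symbol p t = (1 + fps_X) * (\<Prod>i=1..p. fps_const (t i) + fps_X)"

text \<open>The candidate for the generating function of the moments of positive order: its compositional
inverse is \<open>w / ((1 + w) (t\<^sub>1 + w) \<cdots> (t\<^sub>p + w))\<close>, so that the corresponding S-transform is
\<open>1 / ((t\<^sub>1 + w) \<cdots> (t\<^sub>p + w))\<close>.\<close>

definition mp_series :: "nat \<Rightarrow> (nat \<Rightarrow> 'a::field) \<Rightarrow> 'a fps" where
  "mp_series p t = lagrange_series (mp_symbol p t)"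

lemma mp_symbol_nth_0: "fps_nth (mp_symbol p t) 0 = (\<Prod>i=1..p. t i)"
proof -
  have "fps_nth (\<Prod>i\<in>I. f i) 0 = (\<Prod>i\<in>I. fps_nth (f i) 0)" for f :: "nat \<Rightarrow> 'a fps" and I
    by (induction I rule: infinite_finite_induct) simp_all
  then show ?thesis
    by (simp add: mp_symbol_def)
qed

lemma linear_power_expand:
  fixes c :: "'a::field"
  shows "(fps_const c + fps_X) ^ k = (\<Sum>j\<in>{0..k}. fps_const (of_nat (k choose j) * c ^ j) * fps_X ^ (k - j))"
  unfolding binomial_ring atLeast0AtMost
  by (intro sum.cong refl) (simp add: fps_of_nat fps_const_mult[symmetric] fps_const_power del: fps_const_mult)

text \<open>The factor \<open>1 + z\<close> is treated as \<open>t\<^sub>0 + z\<close> with \<open>t\<^sub>0 = 1\<close>. Choosing \<open>t\<^sub>i\<^bsup>j\<^sub>i\<^esup> z\<^bsup>k-j\<^sub>i\<^esup>\<close> from the \<open>i\<close>-th factor, the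
exponents of \<open>z\<close> add up to \<open>k - 1\<close> iff the \<open>j\<^sub>i\<close> add up to \<open>p k + 1\<close>. This also forces all \<open>j\<^sub>i\<close> to be positive,
because none exceeds \<open>k\<close>. The coefficients are stated over an arbitrary real field since both the
real and the complex case occur: moments are real, functionals are complex-valued.\<close>

lemma mp_symbol_power_nth:
  fixes t :: "nat \<Rightarrow> real" and k p :: nat
  assumes "k \<ge> 1"
  shows "fps_nth (mp_symbol p (\<lambda>i. of_real (t i) :: 'a::real_field) ^ k) (k - 1) / of_nat k
    = of_real (fuss_narayana p k t)"
proof -
  define s where "s i = (if i = 0 then 1 else t i)" for i
  let ?E = "{0..p} \<rightarrow>\<^sub>E {0..k}"
  define c where "c j = (\<Prod>i=0..p. real (k choose j i) * s i ^ j i)" for j :: "nat \<Rightarrow> nat"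
  have "mp_symbol p (\<lambda>i. of_real (t i) :: 'a) = (\<Prod>i=0..p. fps_const (of_real (s i)) + fps_X)"
    by (simp add: mp_symbol_def s_def prod.atLeast_Suc_atMost)
  then have "mp_symbol p (\<lambda>i. of_real (t i) :: 'a) ^ k
      = (\<Prod>i=0..p. \<Sum>j\<in>{0..k}. fps_const (of_nat (k choose j) * of_real (s i) ^ j) * fps_X ^ (k - j))"
    by (simp only: prod_power_distrib linear_power_expand)
  also have "\<dots> = (\<Sum>j\<in>?E. \<Prod>i=0..p. fps_const (of_nat (k choose j i) * of_real (s i) ^ j i) * fps_X ^ (k - j i))"
    by (rule prod_sum_PiE) auto
  also have "\<dots> = (\<Sum>j\<in>?E. fps_const (of_real (c j)) * fps_X ^ (\<Sum>i=0..p. k - j i))"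
  proof (intro sum.cong refl)
    fix j
    have "(\<Prod>i\<in>I. fps_const (f i)) = fps_const (\<Prod>i\<in>I. f i)" for f :: "nat \<Rightarrow> 'a" and I
      by (induction I rule: infinite_finite_induct) (simp_all add: fps_const_mult)
    then show "(\<Prod>i=0..p. fps_const (of_nat (k choose j i) * of_real (s i) ^ j i :: 'a) * fps_X ^ (k - j i))
        = fps_const (of_real (c j)) * fps_X ^ (\<Sum>i=0..p. k - j i)"
      unfolding prod.distrib by (simp add: c_def power_sum prod.distrib del: fps_const_mult)
  qed
  finally have "fps_nth (mp_symbol p (\<lambda>i. of_real (t i) :: 'a) ^ k) (k - 1)
      = (\<Sum>j\<in>?E. if k - 1 = (\<Sum>i=0..p. k - j i) then of_real (c j) else 0)"
    by (simp add: fps_sum_nth fps_X_power_nth mult_delta_right cong: if_cong)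
  also have "\<dots> = (\<Sum>j\<in>{j\<in>?E. k - 1 = (\<Sum>i=0..p. k - j i)}. of_real (c j))"
    by (subst sum.If_cases) (auto intro!: finite_PiE simp: Int_def)
  also have "{j\<in>?E. k - 1 = (\<Sum>i=0..p. k - j i)} = {j \<in> {0..p} \<rightarrow>\<^sub>E {1..k}. (\<Sum>i=0..p. j i) = p * k + 1}"
  proof -
    have sum_eq: "(\<Sum>i=0..p. k - j i) + (\<Sum>i=0..p. j i) = (p + 1) * k" if "j \<in> ?E" for j
    proof -
      have "(\<Sum>i=0..p. k - j i) + (\<Sum>i=0..p. j i) = (\<Sum>i=0..p. k)"
        unfolding sum.distrib[symmetric] using that by (intro sum.cong refl) (auto simp: PiE_iff)
      then show ?thesis by simp
    qed
    have "k - 1 = (\<Sum>i=0..p. k - j i) \<longleftrightarrow> (\<Sum>i=0..p. j i) = p * k + 1" if "j \<in> ?E" for j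
      using sum_eq[OF that] assms by auto
    moreover have "j \<in> {0..p} \<rightarrow>\<^sub>E {1..k}" if "j \<in> ?E" and "k - 1 = (\<Sum>i=0..p. k - j i)" for j
    proof -
      have "k - j i \<le> k - 1" if "i \<in> {0..p}" for i
        unfolding \<open>k - 1 = _\<close> using that by (intro member_le_sum) auto
      then have "1 \<le> j i" if "i \<in> {0..p}" for i
        using that assms by force
      then show ?thesis using \<open>j \<in> ?E\<close> by (auto simp: PiE_iff)
    qed
    moreover have "{0..p} \<rightarrow>\<^sub>E {1..k} \<subseteq> ?E"
      by (intro PiE_mono) auto
    ultimately show ?thesis by blast
  qed
  finally have "fps_nth (mp_symbol p (\<lambda>i. of_real (t i) :: 'a) ^ k) (k - 1) / of_nat k
     = of_real (1 / real k * (\<Sum>j \<in> {j \<in> {0..p} \<rightarrow>\<^sub>E {1..k}. (\<Sum>i=0..p. j i) = p * k + 1}. c j))"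
    by simp
  also have "(1 / real k * (\<Sum>j \<in> {j \<in> {0..p} \<rightarrow>\<^sub>E {1..k}. (\<Sum>i=0..p. j i) = p * k + 1}. c j)) = fuss_narayana p k t"
    unfolding fuss_narayana_def sum_distrib_left
    by (intro sum.cong refl) (simp add: c_def prod.distrib s_def prod.atLeast_Suc_atMost)
  finally show ?thesis .
qed

lemma mp_series_nth:
  fixes t :: "nat \<Rightarrow> real"
  assumes "k \<ge> 1" and "\<And>i. i \<in> {1..p} \<Longrightarrow> t i > 0"
  shows "fps_nth (mp_series p (\<lambda>i. of_real (t i) :: 'a::real_field)) k
    = of_real (fuss_narayana p k t)"
proof -
  have "t i \<noteq> 0" if "i \<in> {1..p}" for i
    using assms(2)[OF that] by simp
  then have "fps_nth (mp_symbol p (\<lambda>i. of_real (t i) :: 'a)) 0 \<noteq> 0"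
    by (simp add: mp_symbol_nth_0)
  then show ?thesis
    unfolding mp_series_def
    using lagrange_inversion[OF _ assms(1)] mp_symbol_power_nth[OF assms(1)] by metis
qed

lemma mp_symbol_compose:
  assumes "fps_nth f 0 = 0"
  shows "mp_symbol p t oo f = (1 + f) * (\<Prod>i=1..p. fps_const (t i) + f)"
  unfolding mp_symbol_def
  using assms by (simp add: fps_compose_mult_distrib fps_compose_prod_distrib fps_compose_add_distrib)

lemma mp_series_nth_0:
  assumes "\<And>i. i \<in> {1..p} \<Longrightarrow> t i \<noteq> 0"
  shows "fps_nth (mp_series p t) 0 = 0"
  unfolding mp_series_def by (intro lagrange_series_inverses(1)) (use assms in \<open>simp add: mp_symbol_nth_0\<close>)

lemma mp_series_fixpoint:
  fixes t :: "nat \<Rightarrow> 'a::field"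
  assumes "\<And>i. i \<in> {1..p} \<Longrightarrow> t i \<noteq> 0"
  shows "mp_series p t = fps_X * ((1 + mp_series p t) * (\<Prod>i=1..p. fps_const (t i) + mp_series p t))"
proof -
  let ?M = "mp_series p t"
  have nz: "fps_nth (mp_symbol p t) 0 \<noteq> 0"
    using assms by (simp add: mp_symbol_nth_0)
  have M0: "fps_nth ?M 0 = 0"
    using assms by (rule mp_series_nth_0)
  have "mp_symbol p t oo ?M = (1 + ?M) * (\<Prod>i=1..p. fps_const (t i) + ?M)"
    by (rule mp_symbol_compose[OF M0])
  then show ?thesis
    using lagrange_series_fixpoint[OF nz] unfolding mp_series_def by metis
qed

section \<open>Moments of the Marchenko-Pastur law\<close>

lemma linear_power_nth:
  fixes c :: "'a::field"
  shows "fps_nth ((fps_const c + fps_X) ^ n) i = (if i \<le> n then of_nat (n choose i) * c ^ (n - i) else 0)"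
proof -
  have "fps_nth ((fps_const c + fps_X) ^ n) i = (\<Sum>j\<in>{0..n}. if i = n - j then of_nat (n choose j) * c ^ j else 0)"
    by (simp add: linear_power_expand fps_sum_nth fps_X_power_nth mult_delta_right cong: if_cong)
  also have "\<dots> = (\<Sum>j\<in>{0..n}. if j = n - i then if i \<le> n then of_nat (n choose j) * c ^ j else 0 else 0)"
    by (intro sum.cong refl) auto
  also have "\<dots> = (if i \<le> n then of_nat (n choose i) * c ^ (n - i) else 0)"
    by (auto simp: binomial_symmetric[of i n])
  finally show ?thesis .
qed

text \<open>Lagrange inversion in the form \<open>[z\<^bsup>n+1\<^esup>] M = [z\<^sup>n] P\<^sup>n (P - z P')\<close>, where \<open>P - z P' = t - z\<^sup>2\<close> for
\<open>P = (1 + z) (t + z)\<close>. It gives a difference of two sums, which is the shape in which the moment integral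
arises.\<close>

lemma mp_series_1_nth:
  fixes t :: real
  assumes t: "t > 0"
  shows "fps_nth (mp_series 1 (\<lambda>_. t)) (Suc n)
    = t * ((\<Sum>i\<le>n. (real (n choose i))\<^sup>2 * t ^ i) - (\<Sum>i\<le>n. real (n choose i) * real (n choose (i + 2)) * t ^ (i + 1)))"
proof -
  define P where "P = mp_symbol 1 (\<lambda>_. t)"
  have P: "P = (fps_const 1 + fps_X) * (fps_const t + fps_X)"
    by (simp add: P_def mp_symbol_def)
  have coeff: "fps_nth (P ^ n) m = (\<Sum>i\<le>m. real (n choose i) * real (n choose (m - i)) * t ^ (n - (m - i)))" if "m \<le> n" for m
    unfolding P power_mult_distrib fps_mult_nth linear_power_nth
    using that by (intro sum.cong) auto
  have top: "fps_nth (P ^ n) n = (\<Sum>i\<le>n. (real (n choose i))\<^sup>2 * t ^ i)"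
    unfolding coeff[OF le_refl] by (intro sum.cong refl) (auto simp: power2_eq_square binomial_symmetric[symmetric])
  have low: "fps_nth (P ^ n * fps_X ^ 2) n = t * (\<Sum>i\<le>n. real (n choose i) * real (n choose (i + 2)) * t ^ (i + 1))"
  proof (cases "n < 2")
    case True
    then show ?thesis
      by (auto simp: fps_X_power_mult_right_nth intro!: sum.neutral)
  next
    case False
    then have "fps_nth (P ^ n * fps_X ^ 2) n = (\<Sum>i\<le>n - 2. real (n choose i) * real (n choose (n - 2 - i)) * t ^ (n - (n - 2 - i)))"
      by (simp add: fps_X_power_mult_right_nth coeff)
    also have "\<dots> = (\<Sum>i\<le>n - 2. t * (real (n choose i) * real (n choose (i + 2)) * t ^ (i + 1)))"
    proof (intro sum.cong refl)
      fix i assume "i \<in> {..n - 2}"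
      then have "i + 2 \<le> n" using False by auto
      then have "n choose (n - 2 - i) = n choose (i + 2)" "n - (n - 2 - i) = Suc (i + 1)"
        using binomial_symmetric[of "i + 2" n] by (simp_all add: diff_diff_left add.commute)
      then show "real (n choose i) * real (n choose (n - 2 - i)) * t ^ (n - (n - 2 - i)) = t * (real (n choose i) * real (n choose (i + 2)) * t ^ (i + 1))"
        by simp
    qed
    also have "\<dots> = (\<Sum>i\<le>n. t * (real (n choose i) * real (n choose (i + 2)) * t ^ (i + 1)))"
      by (rule sum.mono_neutral_left) (auto intro!: binomial_eq_0)
    finally show ?thesis by (simp add: sum_distrib_left)
  qed
  have split: "P = fps_X * fps_deriv P + (fps_const t - fps_X ^ 2)"
    by (simp add: P algebra_simps power2_eq_square)
  have "P ^ Suc n = P ^ n * P" by (simp add: mult.commute)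
  also have "\<dots> = fps_X * (P ^ n * fps_deriv P) + P ^ n * (fps_const t - fps_X ^ 2)"
    by (subst (2) split) (simp add: algebra_simps)
  finally have "fps_const (of_nat (Suc n)) * P ^ Suc n
      = fps_const (of_nat (Suc n)) * (fps_X * (P ^ n * fps_deriv P) + P ^ n * (fps_const t - fps_X ^ 2))"
    by (rule arg_cong)
  also have "\<dots> = fps_X * (fps_const (of_nat (Suc n)) * fps_deriv P * P ^ n) + fps_const (of_nat (Suc n)) * (P ^ n * (fps_const t - fps_X ^ 2))"
    by (simp only: distrib_left mult_ac)
  also have "fps_const (of_nat (Suc n)) * fps_deriv P * P ^ n = fps_deriv (P ^ Suc n)"
    by (subst fps_deriv_power) (simp del: of_nat_Suc power_Suc)
  finally have "of_nat (Suc n) * fps_nth (P ^ Suc n) n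
      = fps_nth (fps_X * fps_deriv (P ^ Suc n)) n + of_nat (Suc n) * fps_nth (P ^ n * (fps_const t - fps_X ^ 2)) n"
    by (metis fps_add_nth fps_mult_left_const_nth)
  moreover have "fps_nth (fps_X * fps_deriv (P ^ Suc n)) n = of_nat n * fps_nth (P ^ Suc n) n"
    by (cases n) (simp_all del: power_Suc)
  ultimately have main: "fps_nth (P ^ Suc n) n = of_nat (Suc n) * fps_nth (P ^ n * (fps_const t - fps_X ^ 2)) n"
    by (simp add: distrib_right)
  have "fps_nth P 0 \<noteq> 0"
    using t by (simp add: P_def mp_symbol_nth_0)
  then have "fps_nth (mp_series 1 (\<lambda>_. t)) (Suc n) = fps_nth (P ^ Suc n) n / of_nat (Suc n)"
    unfolding mp_series_def P_def[symmetric] using lagrange_inversion[of P "Suc n"] by simp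
  also have "\<dots> = fps_nth (P ^ n * (fps_const t - fps_X ^ 2)) n"
    unfolding main by simp
  also have "\<dots> = t * fps_nth (P ^ n) n - fps_nth (P ^ n * fps_X ^ 2) n"
    by (simp add: right_diff_distrib mult.commute)
  finally show ?thesis
    unfolding top low by (simp add: right_diff_distrib)
qed

lemma has_integral_cos_multiple:
  "((\<lambda>\<theta>. cos (of_int m * \<theta>)) has_integral (if m = 0 then pi else 0)) {0..pi}"
proof (cases "m = 0")
  case True
  then show ?thesis using has_integral_const_real[of "1 :: real" 0 pi] by simp
next
  case False
  have "((\<lambda>\<theta>. cos (of_int m * \<theta>)) has_integral (sin (of_int m * pi) / of_int m - sin (of_int m * 0) / of_int m)) {0..pi}"
    by (rule fundamental_theorem_of_calculus)
       (use False in \<open>auto intro!: derivative_eq_intros simp flip: has_real_derivative_iff_has_vector_derivative\<close>)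
  then show ?thesis
    using False by (simp add: sin_integer_2pi mult.commute[of _ pi] sin_npi_int)
qed

text \<open>The base is \<open>\<bar>1 + s e\<^sup>i\<^sup>\<theta>\<bar>\<^sup>2\<close>; both factors of \<open>(1 + s e\<^sup>i\<^sup>\<theta>)\<^sup>n (1 + s e\<^sup>-\<^sup>i\<^sup>\<theta>)\<^sup>n\<close> are expanded.\<close>

lemma mp_angle_power:
  fixes s \<theta> :: real
  shows "(1 + s\<^sup>2 + 2 * s * cos \<theta>) ^ n
    = (\<Sum>i\<le>n. \<Sum>j\<le>n. (real (n choose i) * s ^ i) * (real (n choose j) * s ^ j) * cos (of_int (int i - int j) * \<theta>))"
proof -
  let ?z = "complex_of_real s * cis \<theta>" and ?w = "complex_of_real s * cis (- \<theta>)"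
  have pow: "(1 + complex_of_real s * cis \<alpha>) ^ n = (\<Sum>i\<le>n. of_real (real (n choose i) * s ^ i) * cis (real i * \<alpha>))" for \<alpha>
    by (subst add.commute, subst binomial_ring) (simp add: power_mult_distrib Complex.DeMoivre mult.assoc)
  have "complex_of_real (1 + s\<^sup>2 + 2 * s * cos \<theta>) = (1 + ?z) * (1 + ?w)"
    by (simp add: complex_eq_iff power2_eq_square algebra_simps) (metis (no_types) distrib_left mult.assoc mult.commute mult.right_neutral power2_eq_square sin_cos_squared_add2)
  then have "complex_of_real ((1 + s\<^sup>2 + 2 * s * cos \<theta>) ^ n) = (1 + ?z) ^ n * (1 + ?w) ^ n"
    by (metis of_real_power power_mult_distrib)
  also have "\<dots> = (\<Sum>i\<le>n. \<Sum>j\<le>n. of_real ((real (n choose i) * s ^ i) * (real (n choose j) * s ^ j)) * cis (of_int (int i - int j) * \<theta>))"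
    unfolding pow sum_product
  proof (intro sum.cong refl)
    fix i j
    have "cis (of_int (int i - int j) * \<theta>) = cis (real i * \<theta>) * cis (real j * - \<theta>)"
      by (simp add: cis_mult algebra_simps)
    then show "of_real (real (n choose i) * s ^ i) * cis (real i * \<theta>) * (of_real (real (n choose j) * s ^ j) * cis (real j * - \<theta>))
        = of_real ((real (n choose i) * s ^ i) * (real (n choose j) * s ^ j)) * cis (of_int (int i - int j) * \<theta>)"
      by simp
  qed
  finally have "Re (complex_of_real ((1 + s\<^sup>2 + 2 * s * cos \<theta>) ^ n))
      = Re (\<Sum>i\<le>n. \<Sum>j\<le>n. of_real ((real (n choose i) * s ^ i) * (real (n choose j) * s ^ j)) * cis (of_int (int i - int j) * \<theta>))"
    by (rule arg_cong)
  then show ?thesis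
    by (simp only: Re_complex_of_real Re_sum Re_complex_of_real complex_Re_of_int) simp
qed

text \<open>The weight \<open>2 sin\<^sup>2 \<theta> = 1 - cos 2\<theta>\<close> retains the Fourier coefficients of index \<open>0\<close> and \<open>\<plusminus>2\<close> of the expanded
power.\<close>

lemma has_integral_mp_angle:
  fixes t :: real
  assumes t: "t > 0"
  shows "((\<lambda>\<theta>. (1 + t - 2 * sqrt t * cos \<theta>) ^ n * (4 * t * (sin \<theta>)\<^sup>2 / (2 * pi)))
    has_integral fps_nth (mp_series 1 (\<lambda>_. t)) (Suc n)) {0..pi}"
proof -
  define A where "A i = real (n choose i) * (- sqrt t) ^ i" for i
  define d :: "nat \<Rightarrow> nat \<Rightarrow> real" where "d i j = (if i = j then 1 else 0) - (if i = j + 2 then 1 / 2 else 0) - (if j = i + 2 then 1 / 2 else 0)" for i j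
  have sq: "(sqrt t)\<^sup>2 = t" using t by simp
  have trig: "cos (of_int m * \<theta>) * (2 * (sin \<theta>)\<^sup>2)
      = cos (of_int m * \<theta>) - (cos (of_int (m + 2) * \<theta>) + cos (of_int (m - 2) * \<theta>)) / 2" for m :: int and \<theta> :: real
  proof -
    have "cos (of_int (m + 2) * \<theta>) + cos (of_int (m - 2) * \<theta>) = 2 * (cos (of_int m * \<theta>) * cos (2 * \<theta>))"
      by (simp add: distrib_right left_diff_distrib cos_add cos_diff)
    moreover have "2 * (sin \<theta>)\<^sup>2 = 1 - cos (2 * \<theta>)"
      by (simp add: cos_double_sin)
    ultimately show ?thesis
      by (simp add: right_diff_distrib)
  qed
  have int: "((\<lambda>\<theta>. cos (of_int (int i - int j) * \<theta>) * (2 * (sin \<theta>)\<^sup>2)) has_integral pi * d i j) {0..pi}" for i j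
  proof -
    let ?m = "int i - int j"
    have "((\<lambda>\<theta>. cos (of_int ?m * \<theta>) - (cos (of_int (?m + 2) * \<theta>) + cos (of_int (?m - 2) * \<theta>)) / 2) has_integral
        ((if ?m = 0 then pi else 0) - ((if ?m + 2 = 0 then pi else 0) + (if ?m - 2 = 0 then pi else 0)) / 2)) {0..pi}"
      by (intro has_integral_diff has_integral_divide has_integral_add has_integral_cos_multiple)
    moreover have "(if ?m = 0 then pi else 0) - ((if ?m + 2 = 0 then pi else 0) + (if ?m - 2 = 0 then pi else 0)) / 2 = pi * d i j"
      by (auto simp: d_def)
    ultimately show ?thesis by (simp only: trig)
  qed
  have i1: "((\<lambda>\<theta>. (t / pi) * (\<Sum>i\<le>n. \<Sum>j\<le>n. A i * A j * (cos (of_int (int i - int j) * \<theta>) * (2 * (sin \<theta>)\<^sup>2))))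
      has_integral (t / pi) * (\<Sum>i\<le>n. \<Sum>j\<le>n. A i * A j * (pi * d i j))) {0..pi}"
    by (intro has_integral_mult_right has_integral_sum int) auto
  have i2: "(t / pi) * (\<Sum>i\<le>n. \<Sum>j\<le>n. A i * A j * (cos (of_int (int i - int j) * \<theta>) * (2 * (sin \<theta>)\<^sup>2)))
      = (1 + t - 2 * sqrt t * cos \<theta>) ^ n * (4 * t * (sin \<theta>)\<^sup>2 / (2 * pi))" for \<theta>
    using mp_angle_power[of "- sqrt t" \<theta> n]
    by (simp add: sq A_def[symmetric] sum_distrib_right[symmetric] mult.assoc[symmetric])
  have i3: "(t / pi) * (\<Sum>i\<le>n. \<Sum>j\<le>n. A i * A j * (pi * d i j)) = fps_nth (mp_series 1 (\<lambda>_. t)) (Suc n)"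
  proof -
    have A0: "A i = 0" if "i > n" for i
      using that by (simp add: A_def binomial_eq_0)
    have AA: "A i * A i = (real (n choose i))\<^sup>2 * t ^ i" for i
    proof -
      have "A i * A i = (real (n choose i))\<^sup>2 * ((- sqrt t) ^ i * (- sqrt t) ^ i)"
        unfolding A_def power2_eq_square by (simp only: mult_ac)
      also have "(- sqrt t) ^ i * (- sqrt t) ^ i = ((- sqrt t)\<^sup>2) ^ i"
        by (simp only: power_add[symmetric] power_mult[symmetric] mult_2)
      finally show ?thesis using t by simp
    qed
    have AA2: "A i * A (i + 2) = real (n choose i) * real (n choose (i + 2)) * t ^ (i + 1)" for i
    proof -
      have "A i * A (i + 2) = real (n choose i) * real (n choose (i + 2)) * ((- sqrt t) ^ i * (- sqrt t) ^ (i + 2))"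
        unfolding A_def by (simp only: mult_ac)
      also have "(- sqrt t) ^ i * (- sqrt t) ^ (i + 2) = ((- sqrt t)\<^sup>2) ^ (i + 1)"
      proof -
        have "i + (i + 2) = 2 * (i + 1)" by simp
        then show ?thesis
          by (simp only: power_add[symmetric] power_mult[symmetric])
      qed
      finally show ?thesis using t by simp
    qed
    have delta: "(\<Sum>j\<le>n. A j * (if j = k then c else 0)) = A k * c" for k and c :: real
      using A0[of k] by (simp add: sum.delta mult_delta_right)
    have sum1: "(\<Sum>i\<le>n. \<Sum>j\<le>n. A i * A j * (if i = j then 1 else 0)) = (\<Sum>i\<le>n. A i * A i)"
    proof (intro sum.cong refl)
      fix i
      have "(\<Sum>j\<le>n. A i * A j * (if i = j then 1 else 0)) = A i * (\<Sum>j\<le>n. A j * (if j = i then 1 else 0))"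
        unfolding sum_distrib_left by (intro sum.cong refl) auto
      then show "(\<Sum>j\<le>n. A i * A j * (if i = j then 1 else 0)) = A i * A i"
        unfolding delta by simp
    qed
    have sum2: "(\<Sum>i\<le>n. \<Sum>j\<le>n. A i * A j * (if j = i + 2 then 1 / 2 else 0)) = (\<Sum>i\<le>n. A i * A (i + 2)) / 2"
      unfolding mult.assoc sum_distrib_left[symmetric] delta by (simp add: sum_divide_distrib)
    have sum3: "(\<Sum>i\<le>n. \<Sum>j\<le>n. A i * A j * (if i = j + 2 then 1 / 2 else 0)) = (\<Sum>i\<le>n. A i * A (i + 2)) / 2"
      unfolding sum2[symmetric] by (subst sum.swap) (intro sum.cong refl, simp)
    have "(\<Sum>i\<le>n. \<Sum>j\<le>n. A i * A j * d i j) = (\<Sum>i\<le>n. A i * A i) - (\<Sum>i\<le>n. A i * A (i + 2))"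
      unfolding d_def right_diff_distrib sum_subtractf sum1 sum2 sum3 by simp
    then have "(\<Sum>i\<le>n. \<Sum>j\<le>n. A i * A j * (pi * d i j)) = pi * ((\<Sum>i\<le>n. A i * A i) - (\<Sum>i\<le>n. A i * A (i + 2)))"
      by (simp add: sum_distrib_left[symmetric] mult.left_commute[of _ pi])
    then show ?thesis
      unfolding mp_series_1_nth[OF t] AA AA2 by simp
  qed
  show ?thesis
    using i1 unfolding i2 i3 .
qed


text \<open>For \<open>r = sqrt t < 1\<close> the integrand is \<open>1 / \<bar>1 - r e\<^sup>i\<^sup>\<theta>\<bar>\<^sup>2\<close>, the Poisson kernel up to normalisation. It has
the antiderivative \<open>(\<theta> - 2 arg (1 - r e\<^sup>i\<^sup>\<theta>)) / (1 - r\<^sup>2)\<close>, and the argument is a smooth arctangent because \<open>1 - r e\<^sup>i\<^sup>\<theta>\<close>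
stays in the right half-plane. The case \<open>t > 1\<close> follows by replacing \<open>r\<close> by \<open>1 / r\<close>.\<close>

lemma has_integral_poisson_kernel:
  fixes t :: real
  assumes t: "t > 0" "t \<noteq> 1"
  shows "((\<lambda>\<theta>. 1 / (1 + t - 2 * sqrt t * cos \<theta>)) has_integral pi / \<bar>1 - t\<bar>) {0..pi}"
proof -
  have small: "((\<lambda>\<theta>. 1 / (1 + r\<^sup>2 - 2 * r * cos \<theta>)) has_integral pi / (1 - r\<^sup>2)) {0..pi}"
    if r: "0 < r" "r < 1" for r :: real
  proof -
    let ?D = "\<lambda>\<theta>. 1 + r\<^sup>2 - 2 * r * cos \<theta>"
    define G where "G \<theta> = \<theta> + 2 * arctan (r * sin \<theta> / (1 - r * cos \<theta>))" for \<theta>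
    have r2: "r\<^sup>2 < 1" using r by (simp add: power_less_one_iff)
    have "(G has_real_derivative ((1 - r\<^sup>2) / ?D \<theta>)) (at \<theta>)" for \<theta>
    proof -
      have "r * cos \<theta> \<le> r" using r by simp
      then have nz: "1 - r * cos \<theta> > 0" using r by linarith
      define d where "d = 1 - r * cos \<theta>"
      define e where "e = r * sin \<theta>"
      have "d\<^sup>2 + e\<^sup>2 = 1 - 2 * r * cos \<theta> + r\<^sup>2 * ((sin \<theta>)\<^sup>2 + (cos \<theta>)\<^sup>2)"
        unfolding d_def e_def power2_eq_square by algebra
      then have D: "?D \<theta> = d\<^sup>2 + e\<^sup>2" by simp
      have Dpos: "d\<^sup>2 + e\<^sup>2 > 0" and "d > 0"
        using nz by (simp_all add: d_def add_pos_nonneg)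
      have "r * cos \<theta> * d - e * e = r * cos \<theta> - r\<^sup>2 * ((sin \<theta>)\<^sup>2 + (cos \<theta>)\<^sup>2)"
        unfolding d_def e_def power2_eq_square by algebra
      then have E: "r * cos \<theta> * d - e * e = r * cos \<theta> - r\<^sup>2" by simp
      have 1: "((\<lambda>\<theta>. r * sin \<theta>) has_real_derivative r * cos \<theta>) (at \<theta>)"
        by (auto intro!: derivative_eq_intros)
      have 2: "((\<lambda>\<theta>. 1 - r * cos \<theta>) has_real_derivative e) (at \<theta>)"
        by (auto intro!: derivative_eq_intros simp: e_def)
      have 3: "((\<lambda>\<theta>. r * sin \<theta> / (1 - r * cos \<theta>)) has_real_derivative (r * cos \<theta> * d - e * e) / (d * d)) (at \<theta>)"
        using DERIV_divide[OF 1 2] nz unfolding d_def e_def by simp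
      have 4: "((\<lambda>\<theta>. arctan (r * sin \<theta> / (1 - r * cos \<theta>))) has_real_derivative
          inverse (1 + (e / d)\<^sup>2) * ((r * cos \<theta> * d - e * e) / (d * d))) (at \<theta>)"
        using DERIV_chain2[OF DERIV_arctan 3] unfolding d_def e_def .
      have "(G has_real_derivative 1 + 2 * (inverse (1 + (e / d)\<^sup>2) * ((r * cos \<theta> * d - e * e) / (d * d)))) (at \<theta>)"
        unfolding G_def[abs_def] by (intro DERIV_add DERIV_ident DERIV_cmult 4)
      also have "inverse (1 + (e / d)\<^sup>2) = d * d / (d\<^sup>2 + e\<^sup>2)"
        using \<open>d > 0\<close> by (simp add: field_simps power2_eq_square)
      also have "1 + 2 * (d * d / (d\<^sup>2 + e\<^sup>2) * ((r * cos \<theta> * d - e * e) / (d * d))) = (d\<^sup>2 + e\<^sup>2 + 2 * (r * cos \<theta> - r\<^sup>2)) / (d\<^sup>2 + e\<^sup>2)"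
        unfolding E using Dpos \<open>d > 0\<close> by (simp add: add_divide_distrib)
      also have "\<dots> = (1 - r\<^sup>2) / ?D \<theta>"
        unfolding D[symmetric] by simp
      finally show ?thesis .
    qed
    then have "((\<lambda>\<theta>. (1 - r\<^sup>2) / ?D \<theta>) has_integral (G pi - G 0)) {0..pi}"
      by (intro fundamental_theorem_of_calculus)
         (auto simp flip: has_real_derivative_iff_has_vector_derivative intro: has_field_derivative_at_within)
    then have "((\<lambda>\<theta>. (1 / (1 - r\<^sup>2)) * ((1 - r\<^sup>2) / ?D \<theta>)) has_integral (1 / (1 - r\<^sup>2)) * (G pi - G 0)) {0..pi}"
      by (rule has_integral_mult_right)
    then show ?thesis
      using r2 by (simp add: G_def)
  qed
  show ?thesis
  proof (cases "t < 1")
    case True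
    then show ?thesis
      using small[of "sqrt t"] t by simp
  next
    case False
    then have t1: "t > 1" using t by simp
    let ?r = "1 / sqrt t"
    have "((\<lambda>\<theta>. (1 / t) * (1 / (1 + ?r\<^sup>2 - 2 * ?r * cos \<theta>))) has_integral (1 / t) * (pi / (1 - ?r\<^sup>2))) {0..pi}"
      using small[of ?r] t1 by (intro has_integral_mult_right) simp
    moreover have "(1 / t) * (1 / (1 + ?r\<^sup>2 - 2 * ?r * cos \<theta>)) = 1 / (1 + t - 2 * sqrt t * cos \<theta>)" for \<theta>
    proof -
      have "t * (1 + ?r\<^sup>2 - 2 * ?r * cos \<theta>) = t + t * ?r\<^sup>2 - 2 * (t * ?r) * cos \<theta>"
        by (simp add: algebra_simps)
      also have "t * ?r\<^sup>2 = 1" using t1 by (simp add: power_divide)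
      also have "t * ?r = sqrt t" using t1 by (simp add: real_div_sqrt)
      finally show ?thesis by (simp add: add.commute)
    qed
    moreover have "(1 / t) * (pi / (1 - ?r\<^sup>2)) = pi / \<bar>1 - t\<bar>"
      using t1 by (simp add: power_divide field_simps)
    ultimately show ?thesis by simp
  qed
qed

text \<open>The absolutely continuous part has mass \<open>min 1 t\<close>. Dividing \<open>4 t sin\<^sup>2 \<theta> = (x - a) (b - x)\<close> by \<open>x\<close> leaves a linear
function of \<open>x\<close> and a multiple of \<open>1 / x\<close>, which is the Poisson kernel; the multiple vanishes for \<open>t = 1\<close>,
where \<open>x\<close> has a zero at \<open>\<theta> = 0\<close>.\<close>

lemma has_integral_mp_angle_mass:
  fixes t :: real
  assumes t: "t > 0"
  shows "((\<lambda>\<theta>. 4 * t * (sin \<theta>)\<^sup>2 / (2 * pi) / (1 + t - 2 * sqrt t * cos \<theta>)) has_integral min 1 t) {0..pi}"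
proof -
  let ?D = "\<lambda>\<theta>. 1 + t - 2 * sqrt t * cos \<theta>"
  have sin2: "4 * t * (sin \<theta>)\<^sup>2 = - (?D \<theta>)\<^sup>2 + 2 * (1 + t) * ?D \<theta> - (1 - t)\<^sup>2" for \<theta>
  proof -
    have "(2 * sqrt t * cos \<theta>)\<^sup>2 = 4 * t * (1 - (sin \<theta>)\<^sup>2)"
      using t by (simp add: power_mult_distrib cos_squared_eq)
    then show ?thesis by (simp add: power2_eq_square algebra_simps)
  qed
  have cos: "((\<lambda>\<theta>. ?D \<theta>) has_integral (1 + t) * pi - 2 * sqrt t * 0) {0..pi}"
    using has_integral_cos_multiple[of 1] has_integral_const_real[of "1 + t" 0 pi]
    by (intro has_integral_diff has_integral_mult_right) (simp_all add: mult.commute)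
  have const: "((\<lambda>\<theta>. 2 * (1 + t)) has_integral 2 * (1 + t) * pi) {0..pi}"
    using has_integral_const_real[of "2 * (1 + t)" 0 pi] by (simp add: mult_ac)
  show ?thesis
  proof (cases "t = 1")
    case True
    have "((\<lambda>\<theta>. 1 / (2 * pi) * (2 * (1 + t) - ?D \<theta>)) has_integral 1 / (2 * pi) * (2 * (1 + t) * pi - ((1 + t) * pi - 2 * sqrt t * 0))) {0..pi}"
      by (intro has_integral_mult_right has_integral_diff const cos)
    then have *: "((\<lambda>\<theta>. 1 / (2 * pi) * (2 * (1 + t) - ?D \<theta>)) has_integral min 1 t) {0..pi}"
      by (simp add: True)
    show ?thesis
    proof (rule has_integral_spike_finite[OF _ _ *])
      fix \<theta> :: real assume "\<theta> \<in> {0..pi} - {0}"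
      then have "cos \<theta> < cos 0" by (intro cos_monotone_0_pi) auto
      then have "?D \<theta> \<noteq> 0" by (simp add: True)
      then show "4 * t * (sin \<theta>)\<^sup>2 / (2 * pi) / ?D \<theta> = 1 / (2 * pi) * (2 * (1 + t) - ?D \<theta>)"
        unfolding sin2 by (simp add: True field_simps power2_eq_square)
    qed simp
  next
    case False
    have "((\<lambda>\<theta>. 1 / (2 * pi) * (2 * (1 + t) - ?D \<theta> - (1 - t)\<^sup>2 * (1 / ?D \<theta>))) has_integral
        1 / (2 * pi) * (2 * (1 + t) * pi - ((1 + t) * pi - 2 * sqrt t * 0) - (1 - t)\<^sup>2 * (pi / \<bar>1 - t\<bar>))) {0..pi}"
      by (intro has_integral_mult_right has_integral_diff const cos has_integral_poisson_kernel t False)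
    moreover have "1 / (2 * pi) * (2 * (1 + t) - ?D \<theta> - (1 - t)\<^sup>2 * (1 / ?D \<theta>)) = 4 * t * (sin \<theta>)\<^sup>2 / (2 * pi) / ?D \<theta>" for \<theta>
    proof -
      have "0 < (1 - sqrt t)\<^sup>2" using False by simp
      also have "(1 - sqrt t)\<^sup>2 = 1 + t - 2 * sqrt t"
        using t by (simp add: power2_diff)
      also have "\<dots> \<le> ?D \<theta>" using t by simp
      finally show ?thesis
        unfolding sin2 by (simp add: field_simps power2_eq_square)
    qed
    moreover have "1 / (2 * pi) * (2 * (1 + t) * pi - ((1 + t) * pi - 2 * sqrt t * 0) - (1 - t)\<^sup>2 * (pi / \<bar>1 - t\<bar>)) = min 1 t"
    proof -
      have "(1 - t)\<^sup>2 * (pi / \<bar>1 - t\<bar>) = \<bar>1 - t\<bar> * pi"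
        using False by (simp add: power2_eq_square abs_if field_simps)
      then show ?thesis by (simp add: field_simps abs_if min_def)
    qed
    ultimately show ?thesis by simp
  qed
qed

text \<open>The atom at the origin contributes to the moment of order zero only.\<close>

lemma has_integral_mp_substituted:
  fixes t :: real
  assumes t: "t > 0"
  shows "((\<lambda>\<theta>. (1 + t - 2 * sqrt t * cos \<theta>) ^ k * (4 * t * (sin \<theta>)\<^sup>2 / (2 * pi) / (1 + t - 2 * sqrt t * cos \<theta>)))
    has_integral fps_nth (1 + mp_series 1 (\<lambda>_. t)) k - (if k = 0 then max (1 - t) 0 else 0)) {0..pi}"
proof (cases k)
  case 0
  have "fps_nth (mp_series 1 (\<lambda>_. t)) 0 = 0"
    using t unfolding mp_series_def by (intro lagrange_series_inverses(1)) (simp add: mp_symbol_nth_0)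
  moreover have "1 - max (1 - t) 0 = min 1 t" by auto
  ultimately show ?thesis
    using has_integral_mp_angle_mass[OF t] by (simp add: 0)
next
  case (Suc n)
  have "(1 + t - 2 * sqrt t * cos \<theta>) ^ n * (4 * t * (sin \<theta>)\<^sup>2 / (2 * pi))
      = (1 + t - 2 * sqrt t * cos \<theta>) ^ k * (4 * t * (sin \<theta>)\<^sup>2 / (2 * pi) / (1 + t - 2 * sqrt t * cos \<theta>))" for \<theta>
  proof (cases "1 + t - 2 * sqrt t * cos \<theta> = 0")
    case True
    \<comment> \<open>this happens only for \<open>t = 1\<close> and \<open>cos \<theta> = 1\<close>, where the factor \<open>sin \<theta>\<close> vanishes\<close>
    have "(1 - sqrt t)\<^sup>2 + 2 * sqrt t * (1 - cos \<theta>) = 0"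
      using True t by (simp add: power2_diff algebra_simps)
    moreover have "2 * sqrt t * (1 - cos \<theta>) \<ge> 0" using t by simp
    ultimately have "2 * sqrt t * (1 - cos \<theta>) = 0"
      using zero_le_power2[of "1 - sqrt t"] by linarith
    then have "cos \<theta> = 1" using t by simp
    then have "sin \<theta> = 0" by (metis cos_one_sin_zero)
    then show ?thesis by simp
  qed (simp add: Suc)
  then show ?thesis
    using has_integral_mp_angle[OF t, of n] by (simp add: Suc)
qed


lemma mp_density_measurable [measurable]: "mp_density t \<in> borel_measurable borel"
  unfolding mp_density_def Let_def by measurable

lemma nn_integral_marchenko_pastur:
  assumes "f \<in> borel_measurable borel"
  shows "(\<integral>\<^sup>+x. f x \<partial>marchenko_pastur t) = ennreal (max (1 - t) 0) * f 0 + (\<integral>\<^sup>+x. f x * ennreal (mp_density t x) \<partial>lborel)"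
  using assms
proof (induction rule: borel_measurable_induct)
  case (cong f g)
  then show ?case by (simp add: fun_eq_iff)
next
  case (set A)
  then show ?case
    by (simp add: emeasure_marchenko_pastur mult.commute)
next
  case (mult f c)
  have [measurable_cong]: "sets (marchenko_pastur t) = sets borel" by simp
  from mult show ?case
    by (simp add: nn_integral_cmult mult.assoc distrib_left) (simp add: mult.left_commute)
next
  case (add f g)
  have [measurable_cong]: "sets (marchenko_pastur t) = sets borel" by simp
  from add show ?case
    by (simp add: nn_integral_add distrib_left distrib_right add_ac)
next
  case (seq U)
  have [measurable_cong]: "sets (marchenko_pastur t) = sets borel" by simp
  note [measurable] = seq(1)
  have inc: "incseq (\<lambda>i. U i x)" for x
    using seq(3) by (auto simp: incseq_def le_fun_def)
  have "(\<integral>\<^sup>+x. (SUP i. U i) x \<partial>marchenko_pastur t) = (SUP i. \<integral>\<^sup>+x. U i x \<partial>marchenko_pastur t)"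
    unfolding SUP_apply using seq(3) by (intro nn_integral_monotone_convergence_SUP) auto
  also have "\<dots> = (SUP i. ennreal (max (1 - t) 0) * U i 0 + (\<integral>\<^sup>+x. U i x * ennreal (mp_density t x) \<partial>lborel))"
    by (simp add: seq)
  also have "\<dots> = (SUP i. ennreal (max (1 - t) 0) * U i 0) + (SUP i. \<integral>\<^sup>+x. U i x * ennreal (mp_density t x) \<partial>lborel)"
  proof (rule ennreal_SUP_add)
    show "incseq (\<lambda>i. ennreal (max (1 - t) 0) * U i 0)"
      using inc[of 0] by (auto simp: incseq_def intro: mult_left_mono)
    show "incseq (\<lambda>i. \<integral>\<^sup>+x. U i x * ennreal (mp_density t x) \<partial>lborel)"
      using inc by (auto simp: incseq_def intro!: nn_integral_mono mult_right_mono)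
  qed
  also have "(SUP i. ennreal (max (1 - t) 0) * U i 0) = ennreal (max (1 - t) 0) * (SUP i. U i) 0"
    unfolding SUP_apply by (rule SUP_mult_left_ennreal[symmetric])
  also have "(SUP i. \<integral>\<^sup>+x. U i x * ennreal (mp_density t x) \<partial>lborel) = (\<integral>\<^sup>+x. (SUP i. U i x * ennreal (mp_density t x)) \<partial>lborel)"
    using seq(3) by (intro nn_integral_monotone_convergence_SUP[symmetric])
      (auto simp: incseq_def le_fun_def intro!: mult_right_mono)
  also have "\<dots> = (\<integral>\<^sup>+x. (SUP i. U i) x * ennreal (mp_density t x) \<partial>lborel)"
    unfolding SUP_apply by (simp only: SUP_mult_right_ennreal)
  finally show ?case .
qed

text \<open>The angle \<open>\<theta>\<close> parametrises the support: \<open>x - a = 2 sqrt t (1 - cos \<theta>)\<close> and \<open>b - x = 2 sqrt t (1 + cos \<theta>)\<close>, so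
the square root in the density and the derivative of \<open>x\<close> are both \<open>2 sqrt t sin \<theta>\<close>.\<close>

lemma nn_integral_power_mp_density:
  assumes t: "t > 0"
  shows "(\<integral>\<^sup>+x. ennreal (x ^ k) * ennreal (mp_density t x) \<partial>lborel)
    = ennreal (fps_nth (1 + mp_series 1 (\<lambda>_. t)) k - (if k = 0 then max (1 - t) 0 else 0))"
proof -
  define a b where "a = (1 - sqrt t)\<^sup>2" and "b = (1 + sqrt t)\<^sup>2"
  define g where "g \<theta> = 1 + t - 2 * sqrt t * cos \<theta>" for \<theta>
  define f where "f x = x ^ k * (sqrt ((x - a) * (b - x)) / (2 * pi * x))" for x
  have [measurable]: "f \<in> borel_measurable borel"
    unfolding f_def[abs_def] by measurable
  have ab: "g 0 = a" "g pi = b"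
    using t by (simp_all add: g_def a_def b_def power2_diff power2_sum)
  have "(\<integral>\<^sup>+x. ennreal (x ^ k) * ennreal (mp_density t x) \<partial>lborel) = (\<integral>\<^sup>+x. ennreal (f x * indicator {g 0..g pi} x) \<partial>lborel)"
  proof (intro nn_integral_cong)
    fix x
    have "x \<ge> 0" if "a \<le> x"
      using that unfolding a_def by (meson order.trans zero_le_power2)
    then show "ennreal (x ^ k) * ennreal (mp_density t x) = ennreal (f x * indicator {g 0..g pi} x)"
      by (auto simp: ab f_def mp_density_def Let_def a_def[symmetric] b_def[symmetric] indicator_def ennreal_mult[symmetric])
  qed
  also have "\<dots> = (\<integral>\<^sup>+\<theta>. ennreal (f (g \<theta>) * (2 * sqrt t * sin \<theta>) * indicator {0..pi} \<theta>) \<partial>lborel)"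
  proof (rule nn_integral_substitution)
    show "set_borel_measurable borel {g 0..g pi} f"
      unfolding set_borel_measurable_def by measurable
    show "(g has_real_derivative 2 * sqrt t * sin \<theta>) (at \<theta>)" for \<theta>
      unfolding g_def[abs_def] by (auto intro!: derivative_eq_intros)
    show "continuous_on {0..pi} (\<lambda>\<theta>. 2 * sqrt t * sin \<theta>)"
      by (intro continuous_intros)
    show "0 \<le> 2 * sqrt t * sin \<theta>" if "\<theta> \<in> {0..pi}" for \<theta>
      using that t by (intro mult_nonneg_nonneg sin_ge_zero) auto
  qed simp
  also have "\<dots> = (\<integral>\<^sup>+\<theta>. ennreal (indicator {0..pi} \<theta> * (g \<theta> ^ k * (4 * t * (sin \<theta>)\<^sup>2 / (2 * pi) / g \<theta>))) \<partial>lborel)"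
  proof (intro nn_integral_cong)
    fix \<theta>
    have "sqrt ((g \<theta> - a) * (b - g \<theta>)) = 2 * sqrt t * sin \<theta>" if "\<theta> \<in> {0..pi}"
    proof -
      have ga: "g \<theta> - a = 2 * sqrt t * (1 - cos \<theta>)" and gb: "b - g \<theta> = 2 * sqrt t * (1 + cos \<theta>)"
        using t by (simp_all add: g_def a_def b_def power2_diff power2_sum algebra_simps)
      have "(g \<theta> - a) * (b - g \<theta>) = (2 * sqrt t)\<^sup>2 * (1 - (cos \<theta>)\<^sup>2)"
        unfolding ga gb by (simp add: power2_eq_square algebra_simps)
      also have "\<dots> = (2 * sqrt t * sin \<theta>)\<^sup>2"
        by (simp add: sin_squared_eq power_mult_distrib)
      finally show ?thesis
        using that t by (simp add: sin_ge_zero abs_mult)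
    qed
    then have "f (g \<theta>) * (2 * sqrt t * sin \<theta>) = g \<theta> ^ k * (4 * t * (sin \<theta>)\<^sup>2 / (2 * pi) / g \<theta>)" if "\<theta> \<in> {0..pi}"
      using that t unfolding f_def by (simp add: power2_eq_square)
    then show "ennreal (f (g \<theta>) * (2 * sqrt t * sin \<theta>) * indicator {0..pi} \<theta>)
        = ennreal (indicator {0..pi} \<theta> * (g \<theta> ^ k * (4 * t * (sin \<theta>)\<^sup>2 / (2 * pi) / g \<theta>)))"
      by (auto simp: indicator_def)
  qed
  also have "\<dots> = ennreal (fps_nth (1 + mp_series 1 (\<lambda>_. t)) k - (if k = 0 then max (1 - t) 0 else 0))"
  proof (rule nn_integral_has_integral_lebesgue)
    fix \<theta> :: real
    have "0 \<le> (1 - sqrt t)\<^sup>2 + 2 * sqrt t * (1 - cos \<theta>)" using t by simp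
    also have "\<dots> = g \<theta>" using t by (simp add: g_def power2_diff algebra_simps)
    finally show "0 \<le> g \<theta> ^ k * (4 * t * (sin \<theta>)\<^sup>2 / (2 * pi) / g \<theta>)" using t by simp
  next
    show "((\<lambda>\<theta>. g \<theta> ^ k * (4 * t * (sin \<theta>)\<^sup>2 / (2 * pi) / g \<theta>)) has_integral
        fps_nth (1 + mp_series 1 (\<lambda>_. t)) k - (if k = 0 then max (1 - t) 0 else 0)) {0..pi}"
      unfolding g_def using has_integral_mp_substituted[OF t] .
  qed
  finally show ?thesis .
qed

theorem marchenko_pastur_moments:
  assumes t: "t > 0"
  shows "compact_nonneg_prob (marchenko_pastur t)" "moment k (marchenko_pastur t) = fps_nth (1 + mp_series 1 (\<lambda>_. t)) k"
proof -
  let ?\<rho> = "marchenko_pastur t" and ?m = "\<lambda>k. fps_nth (1 + mp_series 1 (\<lambda>_. t)) k"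
  have [measurable_cong]: "sets ?\<rho> = sets borel" by simp
  have space: "space ?\<rho> = UNIV"
    using sets_eq_imp_space_eq[of ?\<rho> borel] by simp
  have m_nonneg: "?m k - (if k = 0 then max (1 - t) 0 else 0) \<ge> 0" for k
  proof (rule has_integral_nonneg[OF has_integral_mp_substituted[OF t]])
    fix \<theta> :: real
    have "0 \<le> (1 - sqrt t)\<^sup>2 + 2 * sqrt t * (1 - cos \<theta>)" using t by simp
    also have "\<dots> = 1 + t - 2 * sqrt t * cos \<theta>" using t by (simp add: power2_diff algebra_simps)
    finally show "0 \<le> (1 + t - 2 * sqrt t * cos \<theta>) ^ k * (4 * t * (sin \<theta>)\<^sup>2 / (2 * pi) / (1 + t - 2 * sqrt t * cos \<theta>))"
      using t by simp
  qed
  have nn: "(\<integral>\<^sup>+x. ennreal (x ^ k) \<partial>?\<rho>) = ennreal (?m k)" for k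
  proof -
    have "(\<integral>\<^sup>+x. ennreal (x ^ k) \<partial>?\<rho>) = ennreal (if k = 0 then max (1 - t) 0 else 0)
        + ennreal (?m k - (if k = 0 then max (1 - t) 0 else 0))"
      by (simp add: nn_integral_marchenko_pastur nn_integral_power_mp_density[OF t] zero_power)
    also have "\<dots> = ennreal ((if k = 0 then max (1 - t) 0 else 0) + (?m k - (if k = 0 then max (1 - t) 0 else 0)))"
      using m_nonneg[of k] by (intro ennreal_plus[symmetric]) auto
    finally show ?thesis by simp
  qed
  have "?m 0 = 1"
    using t unfolding mp_series_def by (simp add: lagrange_series_inverses(1) mp_symbol_nth_0)
  then have "emeasure ?\<rho> (space ?\<rho>) = 1"
    using nn[of 0] by simp
  then have prob: "prob_space ?\<rho>" by (rule prob_spaceI)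
  have supp: "AE x in ?\<rho>. 0 \<le> x \<and> x \<le> (1 + sqrt t)\<^sup>2"
  proof -
    let ?N = "{x. \<not> (0 \<le> x \<and> x \<le> (1 + sqrt t)\<^sup>2)}"
    have N: "?N \<in> sets borel" by measurable
    have "mp_density t x * indicator ?N x = 0" for x
      using order.trans[OF zero_le_power2[of "1 - sqrt t"]] by (auto simp: mp_density_def Let_def indicator_def)
    then have "ennreal (mp_density t x) * indicator ?N x = 0" for x
      by (metis (mono_tags, lifting) ennreal_0 ennreal_indicator ennreal_mult' indicator_pos_le mult.commute mult_zero_right)
    then have "(\<integral>\<^sup>+x\<in>?N. ennreal (mp_density t x) \<partial>lborel) = (\<integral>\<^sup>+(x::real). 0 \<partial>lborel)"
      by (intro nn_integral_cong)
    then have "emeasure ?\<rho> ?N = 0"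
      unfolding emeasure_marchenko_pastur[OF N] by simp
    then show ?thesis
      using N by (intro AE_I[of _ _ ?N]) auto
  qed
  show "compact_nonneg_prob ?\<rho>"
    using prob supp unfolding compact_nonneg_prob_def by auto
  have "AE x in ?\<rho>. 0 \<le> x ^ k"
    using supp by eventually_elim auto
  then have "moment k ?\<rho> = enn2real (\<integral>\<^sup>+x. ennreal (x ^ k) \<partial>?\<rho>)"
    unfolding moment_def by (intro integral_eq_nn_integral) auto
  then show "moment k ?\<rho> = ?m k"
    using m_nonneg[of k] unfolding nn by (auto simp: max_def split: if_splits)
qed

section \<open>Moments of a product of two free variables\<close>

text \<open>The sum of all powers of \<open>G\<close>; if \<open>G\<close> has no constant term, only the powers up to \<open>k\<close> contribute to the
\<open>k\<close>-th coefficient.\<close>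

definition geometric_series :: "'a::ring_1 fps \<Rightarrow> 'a fps" where
  "geometric_series G = Abs_fps (\<lambda>k. \<Sum>n\<le>k. fps_nth (G ^ n) k)"

lemma geometric_series_inverse:
  fixes G :: "'a::ring_1 fps"
  assumes "fps_nth G 0 = 0"
  shows "(1 - G) * geometric_series G = 1" "geometric_series G * (1 - G) = 1"
proof -
  have extend: "fps_nth (geometric_series G) j = (\<Sum>n\<le>k. fps_nth (G ^ n) j)" if "j \<le> k" for j k
    unfolding geometric_series_def fps_nth_Abs_fps
    using that startsby_zero_power_prefix[OF assms] by (intro sum.mono_neutral_left) auto
  have shift: "(\<Sum>n\<le>k. fps_nth (G ^ Suc n) k) = fps_nth (geometric_series G - 1) k" for k
  proof -
    have "(\<Sum>n\<le>Suc k. fps_nth (G ^ n) k) = fps_nth 1 k + (\<Sum>n\<le>k. fps_nth (G ^ Suc n) k)"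
      by (subst sum.atMost_Suc_shift) simp
    then show ?thesis
      using extend[of k "Suc k"] by simp
  qed
  have "fps_nth (G * geometric_series G) k = fps_nth (geometric_series G - 1) k" for k
  proof -
    have "fps_nth (G * geometric_series G) k = (\<Sum>i=0..k. \<Sum>n\<le>k. fps_nth G i * fps_nth (G ^ n) (k - i))"
      by (simp add: fps_mult_nth extend[of _ k] sum_distrib_left)
    also have "\<dots> = (\<Sum>n\<le>k. fps_nth (G ^ Suc n) k)"
      by (subst sum.swap) (simp add: fps_mult_nth)
    finally show ?thesis by (simp only: shift)
  qed
  then have 1: "G * geometric_series G = geometric_series G - 1"
    by (simp add: fps_eq_iff)
  have "fps_nth (geometric_series G * G) k = fps_nth (geometric_series G - 1) k" for k
  proof -
    have "fps_nth (geometric_series G * G) k = (\<Sum>i=0..k. \<Sum>n\<le>k. fps_nth (G ^ n) i * fps_nth G (k - i))"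
      by (simp add: fps_mult_nth extend[of _ k] sum_distrib_right)
    also have "\<dots> = (\<Sum>n\<le>k. fps_nth (G ^ n * G) k)"
      by (subst sum.swap) (simp add: fps_mult_nth)
    finally show ?thesis by (simp only: shift power_Suc2[symmetric])
  qed
  then have 2: "geometric_series G * G = geometric_series G - 1"
    by (simp add: fps_eq_iff)
  show "(1 - G) * geometric_series G = 1" "geometric_series G * (1 - G) = 1"
    by (simp_all add: left_diff_distrib right_diff_distrib 1 2)
qed

context complex_algebra
begin

definition scalar_series :: "complex fps \<Rightarrow> 'a fps" where
  "scalar_series f = Abs_fps (\<lambda>n. scale (fps_nth f n) 1)"

definition functional_series :: "('a \<Rightarrow> complex) \<Rightarrow> 'a fps \<Rightarrow> complex fps" where
  "functional_series \<phi> F = Abs_fps (\<lambda>n. \<phi> (fps_nth F n))"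

lemma scalar_series_mult_nth: "fps_nth (scalar_series f * G) n = (\<Sum>i=0..n. scale (fps_nth f i) (fps_nth G (n - i)))"
  by (simp add: fps_mult_nth scalar_series_def scale_mult_left)

lemma scalar_series_commute: "G * scalar_series f = scalar_series f * G"
proof -
  have "fps_nth (G * scalar_series f) n = fps_nth (scalar_series f * G) n" for n
    unfolding fps_mult_nth scalar_series_def fps_nth_Abs_fps
    by (subst sum.atLeastAtMost_rev) (simp add: scale_mult_left scale_mult_right)
  then show ?thesis by (simp add: fps_eq_iff)
qed

lemma scalar_series_mult: "scalar_series (f * g) = scalar_series f * scalar_series g"
  by (simp add: fps_eq_iff scalar_series_mult_nth)
     (simp add: scalar_series_def fps_mult_nth scale_sum_left)

lemma scalar_series_add: "scalar_series (f + g) = scalar_series f + scalar_series g"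
  by (simp add: fps_eq_iff scalar_series_def scale_left_distrib)

lemma scalar_series_1: "scalar_series 1 = 1"
  by (simp add: fps_eq_iff scalar_series_def)

lemma scalar_series_X: "scalar_series fps_X = fps_X"
  by (simp add: fps_eq_iff scalar_series_def fps_X_def)

lemma scalar_series_power: "scalar_series (f ^ n) = scalar_series f ^ n"
  by (induction n) (simp_all add: scalar_series_1 scalar_series_mult)

lemma unital_functional_simps:
  assumes "unital_functional \<phi>"
  shows "\<phi> (x + y) = \<phi> x + \<phi> y" "\<phi> (x - y) = \<phi> x - \<phi> y" "\<phi> (scale c x) = c * \<phi> x" "\<phi> 0 = 0" "\<phi> 1 = 1"
    "\<phi> (sum f S) = (\<Sum>s\<in>S. \<phi> (f s))"
proof -
  interpret \<phi>: Vector_Spaces.linear scale "(*)" \<phi>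
    using assms by (simp add: unital_functional_def)
  show "\<phi> (x + y) = \<phi> x + \<phi> y" "\<phi> (x - y) = \<phi> x - \<phi> y" "\<phi> (scale c x) = c * \<phi> x" "\<phi> 0 = 0" "\<phi> 1 = 1"
    "\<phi> (sum f S) = (\<Sum>s\<in>S. \<phi> (f s))"
    using assms by (simp_all add: \<phi>.add \<phi>.diff \<phi>.scale \<phi>.zero \<phi>.sum unital_functional_def)
qed

lemma functional_series_simps:
  assumes "unital_functional \<phi>"
  shows "functional_series \<phi> (F + G) = functional_series \<phi> F + functional_series \<phi> G"
    "functional_series \<phi> (scalar_series f * G) = f * functional_series \<phi> G"
    "functional_series \<phi> (scalar_series f) = f"
proof -
  note \<phi> = unital_functional_simps[OF assms]
  show "functional_series \<phi> (F + G) = functional_series \<phi> F + functional_series \<phi> G"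
    by (simp add: fps_eq_iff functional_series_def \<phi>)
  have "fps_nth (functional_series \<phi> (scalar_series f * G)) n = fps_nth (f * functional_series \<phi> G) n" for n
    by (simp add: functional_series_def scalar_series_mult_nth \<phi>) (simp add: fps_mult_nth)
  then show "functional_series \<phi> (scalar_series f * G) = f * functional_series \<phi> G"
    by (simp add: fps_eq_iff)
  show "functional_series \<phi> (scalar_series f) = f"
    by (simp add: fps_eq_iff functional_series_def scalar_series_def \<phi>)
qed

text \<open>Each coefficient of the product is a sum of alternating products of centred elements. In the
induction, the list \<open>as\<close> collects the coefficients already chosen from the leading factors.\<close>

lemma free_vars_series:
  assumes \<phi>: "unital_functional \<phi>" "free_vars \<phi> x I"
    and As: "As \<noteq> []" "\<And>i A n. (i, A) \<in> set As \<Longrightarrow> i \<in> I \<and> fps_nth A n \<in> subalgebra_gen (x i) \<and> \<phi> (fps_nth A n) = 0"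
      "distinct_adj (map fst As)"
  shows "functional_series \<phi> (prod_list (map snd As)) = 0"
proof -
  have "\<phi> (prod_list (map snd as) * fps_nth (prod_list (map snd As)) n) = 0"
    if "as @ map (\<lambda>(i, A). (i, a)) As \<noteq> []"
       "\<And>i a. (i, a) \<in> set as \<Longrightarrow> i \<in> I \<and> a \<in> subalgebra_gen (x i) \<and> \<phi> a = 0"
       "\<And>i A n. (i, A) \<in> set As \<Longrightarrow> i \<in> I \<and> fps_nth A n \<in> subalgebra_gen (x i) \<and> \<phi> (fps_nth A n) = 0"
       "distinct_adj (map fst as @ map fst As)" for as a n
    using that
  proof (induction As arbitrary: as n)
    case Nil
    then have "\<phi> (prod_list (map snd as)) = 0"
      using \<phi>(2)[unfolded free_vars_def, rule_format, of as] by auto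
    then show ?case
      by (simp add: unital_functional_simps[OF \<phi>(1)] fps_one_nth)
  next
    case (Cons iA As)
    obtain i A where iA: "iA = (i, A)" by (cases iA)
    have step: "\<phi> (prod_list (map snd as) * (fps_nth A k * fps_nth (prod_list (map snd As)) (n - k))) = 0" for k
    proof -
      have "\<phi> (prod_list (map snd (as @ [(i, fps_nth A k)])) * fps_nth (prod_list (map snd As)) (n - k)) = 0"
      proof (rule Cons.IH)
        show "i' \<in> I \<and> a' \<in> subalgebra_gen (x i') \<and> \<phi> a' = 0" if "(i', a') \<in> set (as @ [(i, fps_nth A k)])" for i' a'
          using that Cons.prems(2)[of i' a'] Cons.prems(3)[of i A k] iA by auto
        show "i' \<in> I \<and> fps_nth A' n \<in> subalgebra_gen (x i') \<and> \<phi> (fps_nth A' n) = 0" if "(i', A') \<in> set As" for i' A' n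
          using that Cons.prems(3)[of i' A' n] by auto
      qed (use Cons.prems(4) iA in auto)
      then show ?thesis by (simp add: mult.assoc)
    qed
    show ?case
      by (simp add: iA fps_mult_nth sum_distrib_left unital_functional_simps[OF \<phi>(1)] step)
  qed
  from this[of "[]"] show ?thesis
    using As by (simp add: fps_eq_iff functional_series_def)
qed

definition resolvent_series :: "complex fps \<Rightarrow> 'a \<Rightarrow> 'a fps" where
  "resolvent_series u x = geometric_series (scalar_series u * fps_const x)"

lemma resolvent_series_nth:
  "fps_nth (resolvent_series u x) k = (\<Sum>n\<le>k. scale (fps_nth (u ^ n) k) (x ^ n))"
proof -
  have "(scalar_series u * fps_const x) ^ n = scalar_series (u ^ n) * fps_const (x ^ n)" for n
  proof (induction n)
    case (Suc n)
    have "(scalar_series u * fps_const x) ^ Suc n = scalar_series u * (fps_const x * scalar_series (u ^ n)) * fps_const (x ^ n)"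
      by (simp add: Suc mult.assoc)
    also have "fps_const x * scalar_series (u ^ n) = scalar_series (u ^ n) * fps_const x"
      by (rule scalar_series_commute)
    finally show ?case by (simp add: scalar_series_mult mult.assoc)
  qed (simp add: scalar_series_1)
  moreover have "fps_nth (scalar_series f * fps_const y) k = scale (fps_nth f k) y" for f y
    by (simp add: scalar_series_def scale_mult_left)
  ultimately show ?thesis
    by (simp add: resolvent_series_def geometric_series_def)
qed

lemma resolvent_series_inverse:
  assumes "fps_nth u 0 = 0"
  shows "(1 - scalar_series u * fps_const x) * resolvent_series u x = 1"
    "resolvent_series u x * (1 - scalar_series u * fps_const x) = 1"
  unfolding resolvent_series_def
  by (rule geometric_series_inverse; simp add: assms scalar_series_def)+

lemma functional_resolvent_series:
  assumes "unital_functional \<phi>"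
  shows "functional_series \<phi> (resolvent_series u x) = Abs_fps (\<lambda>n. \<phi> (x ^ n)) oo u"
  by (simp add: fps_eq_iff functional_series_def resolvent_series_nth fps_compose_nth
        unital_functional_simps[OF assms] atLeast0AtMost mult.commute)

text \<open>The relation for \<open>1 + w\<close> is the multiplicativity of the S-transform with the argument \<open>w\<close>, \<open>u\<close> and \<open>v\<close>
being the values at \<open>w\<close> of the inverses of the two moment generating functions. Put
\<open>p = 1 - u x\<close>, \<open>q = 1 - v y\<close>, \<open>a = 1 / p\<close>, \<open>b = 1 / q\<close>, \<open>a\<^sub>0 = a - (1 + w)\<close>, \<open>b\<^sub>0 = b - (1 + w)\<close>, \<open>R = 1 / (1 - z x y)\<close> and
\<open>R' = q R p\<close>, so that \<open>R = b R' a\<close>. The choice of \<open>u v\<close> gives \<open>p (w (1 + w) - a\<^sub>0 b\<^sub>0) q = w (1 - z x y)\<close>, hence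
\<open>w (1 + w) R' = w + a\<^sub>0 b\<^sub>0 R'\<close>. For the expectations \<open>f\<^sub>n\<close> of \<open>b (a\<^sub>0 b\<^sub>0)\<^sup>n R' a\<close> this is a recursion, in which
freeness annihilates the inhomogeneous term unless \<open>n = 0\<close>. So \<open>f\<^sub>n\<^sub>+\<^sub>1 = (w (1 + w))\<^sup>n f\<^sub>1\<close> for all \<open>n\<close>. Since
\<open>a\<^sub>0 b\<^sub>0\<close> is divisible by \<open>z\<^sup>2\<close> but \<open>w\<close> only by \<open>z\<close>, this is impossible for large \<open>n\<close> unless \<open>f\<^sub>1 = 0\<close>, and then
the recursion for \<open>n = 0\<close> gives \<open>f\<^sub>0 = 1 + w\<close>.\<close>

theorem free_product_moment_series:
  assumes \<phi>: "unital_functional \<phi>" "free_vars \<phi> x I" and ij: "i \<in> I" "j \<in> I" "i \<noteq> j"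
    and u: "fps_nth u 0 = 0" "Abs_fps (\<lambda>n. \<phi> (x i ^ n)) oo u = 1 + w"
    and v: "fps_nth v 0 = 0" "Abs_fps (\<lambda>n. \<phi> (x j ^ n)) oo v = 1 + w"
    and w: "fps_nth w 0 = 0" "fps_nth w 1 \<noteq> 0" "u * v * (1 + w) = fps_X * w"
  shows "Abs_fps (\<lambda>n. \<phi> ((x i * x j) ^ n)) = 1 + w"
proof -
  let ?S = scalar_series
  let ?\<Phi> = "functional_series \<phi>"
  define a where "a = resolvent_series u (x i)"
  define b where "b = resolvent_series v (x j)"
  define R where "R = resolvent_series fps_X (x i * x j)"
  define W where "W = ?S w"
  define p where "p = 1 - ?S u * fps_const (x i)"
  define q where "q = 1 - ?S v * fps_const (x j)"
  define Z where "Z = 1 - ?S fps_X * fps_const (x i * x j)"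
  define a0 where "a0 = a - (1 + W)"
  define b0 where "b0 = b - (1 + W)"
  define R' where "R' = q * R * p"
  note \<Phi> = functional_series_simps[OF \<phi>(1)]
  have W: "G * W = W * G" for G
    unfolding W_def by (rule scalar_series_commute)
  have W': "G * (W * H) = W * (G * H)" for G H
    by (metis W mult.assoc)
  \<comment> \<open>as rewrite rules, the two commutation laws loop on \<open>W * W\<close>, hence the instances\<close>
  note Wc = W[of a] W'[of a] W[of b] W'[of b] W[of a0] W'[of a0] W[of b0] W'[of b0] W[of p] W'[of p] W[of q] W'[of q] W[of R] W'[of R] W[of R'] W'[of R'] W[of "(a0 * b0) ^ n" for n] W'[of "(a0 * b0) ^ n" for n]
  have inv: "p * a = 1" "a * p = 1" "q * b = 1" "b * q = 1" "Z * R = 1" "R * Z = 1"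
    unfolding a_def b_def R_def p_def q_def Z_def
    by (rule resolvent_series_inverse; simp add: u v)+

  have D: "W * (1 + W) - a0 * b0 = W * (a * b) - (1 + W) * ((a - 1) * (b - 1))"
    by (simp add: a0_def b0_def algebra_simps Wc)
  have "p * (W * (1 + W) - a0 * b0) * q = W * ((p * a) * (b * q)) - (1 + W) * ((p * a - p) * (b * q - q))"
    unfolding D by (simp add: algebra_simps Wc)
  also have "\<dots> = W - (1 + W) * ((1 - p) * (1 - q))"
    by (simp add: inv)
  also have "(1 + W) * ((1 - p) * (1 - q)) = ?S (u * v * (1 + w)) * (fps_const (x i) * fps_const (x j))"
  proof -
    have "(1 + W) * ((1 - p) * (1 - q)) = ?S (1 + w) * (?S u * (fps_const (x i) * ?S v) * fps_const (x j))"
      by (simp add: p_def q_def W_def scalar_series_add scalar_series_1 mult.assoc)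
    also have "fps_const (x i) * ?S v = ?S v * fps_const (x i)"
      by (rule scalar_series_commute)
    also have "?S (1 + w) * (?S u * (?S v * fps_const (x i)) * fps_const (x j))
        = ?S ((1 + w) * (u * v)) * (fps_const (x i) * fps_const (x j))"
      unfolding scalar_series_mult mult.assoc ..
    finally show ?thesis by (simp only: mult.commute)
  qed
  also have "W - \<dots> = W * Z"
  proof -
    have "u * v * (1 + w) = w * fps_X"
      by (metis w(3) mult.commute)
    then show ?thesis
      by (simp add: Z_def W_def scalar_series_mult right_diff_distrib mult.assoc)
  qed
  finally have pDq: "p * (W * (1 + W) - a0 * b0) * q = W * Z" .
  have "(W * (1 + W) - a0 * b0) * R' = (a * p) * (W * (1 + W) - a0 * b0) * (q * R * p)"
    by (simp add: inv R'_def)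
  also have "\<dots> = a * (p * (W * (1 + W) - a0 * b0) * q) * (R * p)"
    by (simp only: mult.assoc)
  also have "\<dots> = W * (a * (Z * R) * p)"
    unfolding pDq by (simp add: mult.assoc Wc)
  finally have DR: "W * (1 + W) * R' = W + a0 * b0 * R'"
    by (simp add: inv left_diff_distrib diff_eq_eq)

  define f where "f n = ?\<Phi> (b * (a0 * b0) ^ n * R' * a)" for n
  define g where "g n = ?\<Phi> (b * (a0 * b0) ^ n * a)" for n
  have rec: "w * (1 + w) * f n = w * g n + f (Suc n)" for n
  proof -
    have "?S (w * (1 + w)) * (b * (a0 * b0) ^ n * R' * a) = b * (a0 * b0) ^ n * (W * (1 + W) * R') * a"
      by (simp add: scalar_series_mult scalar_series_add scalar_series_1 flip: W_def)
         (simp add: mult.assoc Wc distrib_left distrib_right)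
    also have "\<dots> = ?S w * (b * (a0 * b0) ^ n * a) + b * (a0 * b0) ^ Suc n * R' * a"
      unfolding DR by (simp add: power_Suc2 distrib_left distrib_right W_def[symmetric] mult.assoc Wc del: power_Suc)
    finally show ?thesis
      unfolding f_def g_def by (metis \<Phi>(1,2))
  qed

  have Phi_ab: "?\<Phi> a = 1 + w" "?\<Phi> b = 1 + w"
    using u v by (simp_all add: a_def b_def functional_resolvent_series[OF \<phi>(1)])
  have span1: "scale c 1 \<in> subalgebra_gen z" for c z
    unfolding subalgebra_gen_def by (intro span_scale span_base) (auto intro: exI[of _ 0])
  have res_gen: "fps_nth (resolvent_series c z) n \<in> subalgebra_gen z" for c z n
    unfolding subalgebra_gen_def resolvent_series_nth by (intro span_sum span_scale span_base) auto
  have centred: "fps_nth a0 n \<in> subalgebra_gen (x i) \<and> \<phi> (fps_nth a0 n) = 0"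
    "fps_nth b0 n \<in> subalgebra_gen (x j) \<and> \<phi> (fps_nth b0 n) = 0" for n
  proof -
    have 1: "1 + W = ?S (1 + w)"
      by (simp add: W_def scalar_series_add scalar_series_1)
    have "fps_nth a0 n \<in> subalgebra_gen (x i)" "fps_nth b0 n \<in> subalgebra_gen (x j)"
      using res_gen span1 unfolding a0_def b0_def 1 a_def b_def scalar_series_def
      by (auto simp: subalgebra_gen_def intro!: span_diff)
    moreover have "\<phi> (fps_nth a0 n) = 0" "\<phi> (fps_nth b0 n) = 0"
      using Phi_ab unfolding a0_def b0_def 1
      by (simp_all add: unital_functional_simps[OF \<phi>(1)] scalar_series_def functional_series_def fps_eq_iff)
    ultimately show "fps_nth a0 n \<in> subalgebra_gen (x i) \<and> \<phi> (fps_nth a0 n) = 0"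
      "fps_nth b0 n \<in> subalgebra_gen (x j) \<and> \<phi> (fps_nth b0 n) = 0" by auto
  qed

  define L where "L n = concat (replicate n [(i, a0), (j, b0)])" for n
  have L_Suc: "L (Suc n) = (i, a0) # (j, b0) # L n" for n
    by (simp add: L_def)
  have L_prod: "prod_list (map snd (L n)) = (a0 * b0) ^ n" for n
    by (induction n) (simp add: L_def, simp add: L_Suc mult.assoc)
  have L_adj: "distinct_adj (map fst ([(j, b0)] @ L n @ [(i, a0)]))" for n
    using ij by (induction n) (simp add: L_def, simp add: L_Suc)
  have L_set: "set (L n) \<subseteq> {(i, a0), (j, b0)}" for n
    by (induction n) (simp add: L_def, auto simp add: L_Suc)
  have free0: "?\<Phi> (prod_list (map snd As)) = 0"
    if "As \<noteq> []" "set As \<subseteq> {(i, a0), (j, b0)}" "distinct_adj (map fst As)" for As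
    by (rule free_vars_series[OF \<phi> that(1) _ that(3)]) (use that(2) ij centred in auto)
  have alt: "?\<Phi> (b0 * (a0 * b0) ^ n * a0) = 0" "?\<Phi> (b0 * (a0 * b0) ^ n) = 0" "?\<Phi> ((a0 * b0) ^ n * a0) = 0"
    "?\<Phi> ((a0 * b0) ^ n) = (if n = 0 then 1 else 0)" for n
  proof -
    note adj = L_adj[of n, unfolded map_append]
    show "?\<Phi> (b0 * (a0 * b0) ^ n * a0) = 0"
      using free0[of "[(j, b0)] @ L n @ [(i, a0)]"] L_set[of n] L_adj[of n] by (simp add: L_prod mult.assoc)
    show "?\<Phi> (b0 * (a0 * b0) ^ n) = 0"
      using free0[of "[(j, b0)] @ L n"] L_set[of n] adj
      by (metis (no_types, lifting) L_prod append_assoc append_Cons append_Nil distinct_adj_appendD1 empty_subsetI insertI1 insertI2 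
          insert_subset list.distinct(1) list.set(2) list.simps(9) map_append prod_list.Cons snd_conv)
    show "?\<Phi> ((a0 * b0) ^ n * a0) = 0"
      using free0[of "L n @ [(i, a0)]"] L_set[of n] distinct_adj_appendD2[OF adj] by (simp add: L_prod)
    show "?\<Phi> ((a0 * b0) ^ n) = (if n = 0 then 1 else 0)"
    proof (cases n)
      case 0
      then show ?thesis using \<Phi>(3)[of 1] by (simp add: scalar_series_1)
    next
      case (Suc m)
      then show ?thesis
        using free0[of "L n"] L_set[of n] distinct_adj_appendD1[OF distinct_adj_appendD2[OF adj]]
        by (simp add: L_prod del: power_Suc) (simp add: L_Suc)
    qed
  qed
  have g: "g n = (if n = 0 then (1 + w) ^ 2 else 0)" for n
  proof -
    have "b * (a0 * b0) ^ n * a = b0 * (a0 * b0) ^ n * a0 + ?S (1 + w) * (b0 * (a0 * b0) ^ n)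
        + ?S (1 + w) * ((a0 * b0) ^ n * a0) + ?S ((1 + w) ^ 2) * (a0 * b0) ^ n"
    proof -
      have ab: "a = a0 + (1 + W)" "b = b0 + (1 + W)" by (simp_all add: a0_def b0_def)
      show ?thesis
        unfolding ab
        by (simp add: power2_eq_square scalar_series_mult scalar_series_add scalar_series_1 flip: W_def)
           (simp add: distrib_left distrib_right mult.assoc Wc add_ac)
    qed
    then show ?thesis
      unfolding g_def by (simp add: \<Phi>(1,2) alt)
  qed

  have X_dvd: "\<exists>h. f n = fps_X ^ (2 * n) * h" for n
  proof -
    have 0: "fps_nth a0 0 = 0" "fps_nth b0 0 = 0"
      unfolding a0_def b0_def a_def b_def W_def
      by (simp_all add: resolvent_series_nth scalar_series_def w)
    obtain a1 b1 where ab1: "a0 = fps_X * a1" "b0 = fps_X * b1"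
    proof
      show "a0 = fps_X * fps_shift 1 a0" "b0 = fps_X * fps_shift 1 b0"
        using 0 by (simp_all add: fps_eq_iff)
    qed
    have "(a0 * b0) ^ n = fps_X ^ (2 * n) * (a1 * b1) ^ n"
    proof (induction n)
      case (Suc n)
      have "a0 * b0 = fps_X * (a1 * fps_X) * b1"
        by (simp only: ab1 mult.assoc)
      also have "a1 * fps_X = fps_X * a1"
        by (rule fps_mult_fps_X_commute[symmetric])
      finally have ab: "a0 * b0 = fps_X ^ 2 * (a1 * b1)"
        by (simp only: power2_eq_square mult.assoc)
      have "(a0 * b0) ^ Suc n = (fps_X ^ 2 * (a1 * b1)) * (fps_X ^ (2 * n) * (a1 * b1) ^ n)"
        unfolding power_Suc Suc.IH unfolding ab ..
      also have "\<dots> = fps_X ^ 2 * ((a1 * b1) * fps_X ^ (2 * n)) * (a1 * b1) ^ n"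
        by (simp only: mult.assoc)
      also have "(a1 * b1) * fps_X ^ (2 * n) = fps_X ^ (2 * n) * (a1 * b1)"
        by (rule fps_mult_fps_X_power_commute[symmetric])
      also have "fps_X ^ 2 * (fps_X ^ (2 * n) * (a1 * b1)) * (a1 * b1) ^ n = fps_X ^ (2 * Suc n) * (a1 * b1) ^ Suc n"
        by (simp add: mult.assoc power2_eq_square)
      finally show ?case .
    qed simp
    then have "b * (a0 * b0) ^ n * R' * a = (b * fps_X ^ (2 * n)) * ((a1 * b1) ^ n * R' * a)"
      by (simp add: mult.assoc)
    also have "b * fps_X ^ (2 * n) = fps_X ^ (2 * n) * b"
      by (rule fps_mult_fps_X_power_commute[symmetric])
    also have "fps_X ^ (2 * n) * b * ((a1 * b1) ^ n * R' * a) = ?S (fps_X ^ (2 * n)) * (b * (a1 * b1) ^ n * R' * a)"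
      by (simp add: scalar_series_power scalar_series_X mult.assoc)
    finally show ?thesis
      unfolding f_def using \<Phi>(2) by auto
  qed
  have w0: "w \<noteq> 0" "1 + w \<noteq> 0"
  proof -
    have "fps_nth (1 + w) 0 \<noteq> 0"
      using w(1) by simp
    then show "1 + w \<noteq> 0" by force
    show "w \<noteq> 0" using w(2) by force
  qed
  have "f (Suc 0) = 0"
  proof (rule ccontr)
    assume f1: "f (Suc 0) \<noteq> 0"
    have rec1: "f (Suc (Suc n)) = w * (1 + w) * f (Suc n)" for n
      using rec[of "Suc n"] g[of "Suc n"] by simp
    have pow: "(w * (1 + w)) ^ n * f (Suc 0) = f (Suc n)" for n
    proof (induction n)
      case (Suc n)
      show ?case unfolding rec1 Suc.IH[symmetric] by (simp only: power_Suc mult.assoc)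
    qed simp
    define n where "n = subdegree (f (Suc 0))"
    have sw: "subdegree w = 1" "subdegree (1 + w) = 0"
      using w by (auto intro!: subdegreeI)
    obtain h where h: "f (Suc n) = fps_X ^ (2 * Suc n) * h"
      using X_dvd by blast
    have "f (Suc n) \<noteq> 0"
      using pow[of n, symmetric] f1 w0 by simp
    moreover have "fps_nth (f (Suc n)) i = 0" if "i < 2 * Suc n" for i
      unfolding h using that by (simp only: fps_X_power_mult_nth if_True)
    ultimately have "subdegree (f (Suc n)) \<ge> 2 * Suc n"
      by (intro subdegree_geI)
    moreover have "subdegree (f (Suc n)) = 2 * n"
      unfolding pow[of n, symmetric] using f1 w0 by (simp add: sw n_def[symmetric])
    ultimately show False by simp
  qed
  then have "w * ((1 + w) * f 0) = w * ((1 + w) * (1 + w))"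
    using rec[of 0] by (simp add: g power2_eq_square mult.assoc)
  then have "f 0 = 1 + w"
    using w0 by simp
  moreover have "f 0 = ?\<Phi> R"
  proof -
    have "b * R' * a = (b * q) * R * (p * a)"
      by (simp add: R'_def mult.assoc)
    then show ?thesis by (simp add: f_def inv)
  qed
  moreover have "?\<Phi> R = Abs_fps (\<lambda>n. \<phi> ((x i * x j) ^ n))"
    by (simp add: R_def functional_resolvent_series[OF \<phi>(1)])
  ultimately show ?thesis by simp
qed

end

section \<open>Existence of free variables with prescribed moments\<close>

text \<open>The algebra generated by the \<open>i\<close>-th variable \<open>x\<close> is spanned by \<open>1\<close> and the centred powers
\<open>x\<^sup>n - m i n\<close>, \<open>n \<ge> 1\<close>. So the algebraic free product has a basis indexed by alternating lists of
pairs \<open>(i, n)\<close>, the pair standing for such a centred power, and \<open>x\<close> acts on it by multiplication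
from the left: it prepends \<open>(i, 1)\<close> and adds \<open>m i 1\<close> times the identity, or, if the list starts with \<open>(i, n)\<close>,
it acts by
\<open>x (x\<^sup>n - m i n) = (x\<^sup>n\<^sup>+\<^sup>1 - m i (n + 1)) - m i n (x - m i 1) + (m i (n + 1) - m i n m i 1)\<close>.
The function below is the transpose of this action. It operates on arbitrary functions of lists,
which avoids linear combinations of basis vectors; the order of factors is reversed.\<close>

fun letter_dual :: "('i \<Rightarrow> nat \<Rightarrow> complex) \<Rightarrow> 'i \<Rightarrow> (('i \<times> nat) list \<Rightarrow> complex) \<Rightarrow> ('i \<times> nat) list \<Rightarrow> complex" where
  "letter_dual m i f [] = f [(i, 1)] + m i 1 * f []"
| "letter_dual m i f ((j, n) # w) =
     (if j = i then f ((i, n + 1) # w) - m i n * f ((i, 1) # w) + (m i (n + 1) - m i n * m i 1) * f w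
      else f ((i, 1) # (j, n) # w) + m i 1 * f ((j, n) # w))"

definition word_dual :: "('i \<Rightarrow> nat \<Rightarrow> complex) \<Rightarrow> 'i word \<Rightarrow> (('i \<times> nat) list \<Rightarrow> complex) \<Rightarrow> ('i \<times> nat) list \<Rightarrow> complex" where
  "word_dual m u = fold (letter_dual m) (letters u)"

definition poly_dual :: "('i \<Rightarrow> nat \<Rightarrow> complex) \<Rightarrow> 'i nc_poly \<Rightarrow> (('i \<times> nat) list \<Rightarrow> complex) \<Rightarrow> ('i \<times> nat) list \<Rightarrow> complex" where
  "poly_dual m p f w = (\<Sum>u\<in>Poly_Mapping.keys p. Poly_Mapping.lookup p u * word_dual m u f w)"

definition free_functional :: "('i \<Rightarrow> nat \<Rightarrow> complex) \<Rightarrow> 'i nc_poly \<Rightarrow> complex" where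
  "free_functional m p = poly_dual m p (\<lambda>w. if w = [] then 1 else 0) []"

lemma letter_dual_linear:
  "letter_dual m i (\<lambda>v. \<Sum>s\<in>S. c s * f s v) w = (\<Sum>s\<in>S. c s * letter_dual m i (f s) w)"
proof (cases w)
  case Nil
  then show ?thesis by (simp add: sum_distrib_left sum.distrib algebra_simps)
next
  case (Cons a v)
  then show ?thesis
    by (cases a) (simp add: sum_distrib_left sum.distrib sum_subtractf algebra_simps)
qed

lemma word_dual_linear:
  "word_dual m u (\<lambda>v. \<Sum>s\<in>S. c s * f s v) w = (\<Sum>s\<in>S. c s * word_dual m u (f s) w)"
proof -
  have "fold (letter_dual m) ls (\<lambda>v. \<Sum>s\<in>S. c s * f s v) = (\<lambda>w. \<Sum>s\<in>S. c s * fold (letter_dual m) ls (f s) w)" for ls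
    by (induction ls arbitrary: f) (simp_all add: letter_dual_linear[abs_def])
  then show ?thesis by (simp add: word_dual_def)
qed

lemma word_dual_plus: "word_dual m (u + v) f = word_dual m v (word_dual m u f)"
  by (simp add: word_dual_def plus_word_def)

lemma poly_dual_superset:
  assumes "finite S" "Poly_Mapping.keys p \<subseteq> S"
  shows "poly_dual m p f w = (\<Sum>u\<in>S. Poly_Mapping.lookup p u * word_dual m u f w)"
  unfolding poly_dual_def using assms by (intro sum.mono_neutral_left) (auto simp: in_keys_iff)

lemma poly_dual_add: "poly_dual m (p + q) f w = poly_dual m p f w + poly_dual m q f w"
proof -
  let ?S = "Poly_Mapping.keys p \<union> Poly_Mapping.keys q"
  show ?thesis
    using Poly_Mapping.keys_add[of p q]
    by (simp add: poly_dual_superset[of ?S] lookup_add sum.distrib distrib_right)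
qed

lemma poly_dual_single: "poly_dual m (Poly_Mapping.single u c) f w = c * word_dual m u f w"
  by (simp add: poly_dual_superset[of "{u}"])

lemma poly_dual_linear: "poly_dual m p (\<lambda>v. \<Sum>s\<in>S. c s * f s v) w = (\<Sum>s\<in>S. c s * poly_dual m p (f s) w)"
  unfolding poly_dual_def word_dual_linear sum_distrib_left
  by (subst sum.swap) (simp add: mult_ac)

lemma nc_poly_induct [case_names add single]:
  assumes "\<And>p q. P p \<Longrightarrow> P q \<Longrightarrow> P (p + q)" "\<And>u c. P (Poly_Mapping.single u c)"
  shows "P (p :: 'v nc_poly)"
proof (induction p rule: update_induct)
  case const
  then show ?case using assms(2)[of 0 0] by simp
next
  case (update p u c)
  then have "Poly_Mapping.update u c p = p + Poly_Mapping.single u c"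
    by (intro poly_mapping_eqI) (auto simp: lookup_update lookup_add lookup_single when_def in_keys_iff)
  then show ?case using assms update by simp
qed

lemma poly_dual_mult: "poly_dual m (p * q) f w = poly_dual m q (poly_dual m p f) w"
proof (induction p arbitrary: w rule: nc_poly_induct)
  case (add p p')
  have "poly_dual m (p + p') f = (\<lambda>v. \<Sum>b\<in>UNIV. 1 * (if b then poly_dual m p f else poly_dual m p' f) v)"
    by (simp add: fun_eq_iff poly_dual_add UNIV_bool)
  then have "poly_dual m q (poly_dual m (p + p') f) w = poly_dual m q (poly_dual m p f) w + poly_dual m q (poly_dual m p' f) w"
    by (simp only: poly_dual_linear) (simp add: UNIV_bool)
  moreover have "poly_dual m ((p + p') * q) f w = poly_dual m (p * q) f w + poly_dual m (p' * q) f w"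
    by (simp add: distrib_right poly_dual_add)
  ultimately show ?case
    by (simp only: add.IH)
next
  case (single u c)
  have *: "poly_dual m (Poly_Mapping.single u c) f = (\<lambda>v. \<Sum>b\<in>{()}. c * word_dual m u f v)"
    by (simp add: fun_eq_iff poly_dual_single)
  show ?case
    unfolding * poly_dual_linear
  proof (induction q rule: nc_poly_induct)
    case (add q q')
    then show ?case by (simp add: poly_dual_add distrib_left)
  next
    case (single v d)
    then show ?case by (simp add: poly_dual_single mult_single word_dual_plus)
  qed
qed

lemma nc_var_power: "nc_var i ^ n = Poly_Mapping.single (Word (replicate n i)) 1"
proof (induction n)
  case 0
  then show ?case by (metis power_0 replicate_0 single_one zero_word_def)
next
  case (Suc n)
  then show ?case by (simp add: nc_var_def mult_single plus_word_def)
qed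

text \<open>A list that does not start with \<open>i\<close> behaves like the unit for the algebra of the \<open>i\<close>-th variable: \<open>x\<^sup>n\<close>
sends it to the centred power plus the moment.\<close>

lemma poly_dual_power:
  assumes "distinct_adj (i # map fst w)" "m i 0 = 1"
  shows "poly_dual m (nc_var i ^ n) f w = (if n = 0 then f w else f ((i, n) # w) + m i n * f w)"
proof -
  have w: "letter_dual m i f w = f ((i, 1) # w) + m i 1 * f w" for f
    using assms by (cases w) auto
  have "fold (letter_dual m) (replicate (Suc n) i) f w = f ((i, Suc n) # w) + m i (Suc n) * f w" for n f
    by (induction n arbitrary: f) (simp_all add: w algebra_simps)
  from this[of "n - 1" f] show ?thesis
    unfolding nc_var_power poly_dual_single word_dual_def by (cases "n = 0") simp_all
qed

lemma free_functional_add: "free_functional m (p + q) = free_functional m p + free_functional m q"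
  by (simp add: free_functional_def poly_dual_add)

lemma poly_dual_scale: "poly_dual m (nc_scale c p) f w = c * poly_dual m p f w"
  unfolding nc_scale_def nc_scalar_commute
  by (simp add: poly_dual_mult poly_dual_single word_dual_def zero_word_def)

lemma free_functional_scale: "free_functional m (nc_scale c p) = c * free_functional m p"
  by (simp add: free_functional_def poly_dual_scale)

text \<open>By linearity, a centred element of the \<open>i\<close>-th algebra sends a list not starting with \<open>i\<close> to a combination
of lists that are longer by one pair \<open>(i, n)\<close>.\<close>

lemma poly_dual_centred:
  assumes "a \<in> nc_poly.subalgebra_gen (nc_var i)" "distinct_adj (i # map fst w)" "m i 0 = 1"
    and "\<And>n. f ((i, n) # w) = 0"
  shows "poly_dual m a f w = free_functional m a * f w"
  using assms(1) unfolding nc_poly.subalgebra_gen_def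
proof (induction a rule: nc_poly.span_induct_alt)
  case base
  then show ?case by (simp add: free_functional_def poly_dual_def)
next
  case (step c x y)
  then obtain n where x: "x = nc_var i ^ n" by auto
  have "free_functional m x = m i n"
    unfolding x free_functional_def using assms(3) by (simp add: poly_dual_power)
  moreover have "poly_dual m x f w = m i n * f w"
    unfolding x using assms by (simp add: poly_dual_power)
  ultimately show ?case
    using step by (simp add: poly_dual_add poly_dual_scale free_functional_def algebra_simps)
qed

text \<open>An alternating product of centred elements thus maps the empty list to a combination of lists of
the same length as the product, and these are orthogonal to the empty list. In the induction the
list \<open>w\<close> is one that occurs in the image of the empty list under the factors to the right.\<close>

theorem free_functional:
  assumes "\<And>i. m i 0 = 1"
  shows "nc_poly.unital_functional (free_functional m)"
    and "nc_poly.free_vars (free_functional m) nc_var UNIV"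
    and "free_functional m (nc_var i ^ n) = m i n"
proof -
  show "free_functional m (nc_var i ^ n) = m i n" for i n
    using assms by (simp add: free_functional_def poly_dual_power)
  from this[of undefined 0] have "free_functional m 1 = 1"
    using assms by simp
  moreover have "Vector_Spaces.linear nc_scale (*) (free_functional m)"
    by unfold_locales (simp_all add: free_functional_add free_functional_scale algebra_simps)
  ultimately show "nc_poly.unital_functional (free_functional m)"
    by (simp add: nc_poly.unital_functional_def)
  have "poly_dual m (prod_list (map snd as)) f w = 0"
    if "\<And>i a. (i, a) \<in> set as \<Longrightarrow> a \<in> nc_poly.subalgebra_gen (nc_var i) \<and> free_functional m a = 0"
      "distinct_adj (map fst as @ map fst w)" "\<And>v. length v = length as + length w \<Longrightarrow> f v = 0" for as f w
    using that
  proof (induction as arbitrary: w rule: rev_induct)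
    case Nil
    have "poly_dual m 1 f w = f w"
      using poly_dual_single[of m 0 1 f w] unfolding single_one by (simp add: word_dual_def zero_word_def)
    then show ?case
      using Nil by simp
  next
    case (snoc ia as)
    obtain i a where ia: "ia = (i, a)" by (cases ia)
    have *: "poly_dual m (prod_list (map snd as)) f ((i, n) # w) = 0" for n
      by (rule snoc.IH) (use snoc.prems ia in auto)
    have "distinct_adj (i # map fst w)"
      using snoc.prems(2) ia by (auto dest: distinct_adj_appendD2)
    then show ?case
      using snoc.prems(1)[of i a] ia assms
      by (simp add: poly_dual_mult poly_dual_centred[where f = "poly_dual m (prod_list (map snd as)) f" and i = i, OF _ _ _ *])
  qed
  from this[where w = "[]"]
  have "poly_dual m (prod_list (map snd as)) (\<lambda>w. if w = [] then 1 else 0) [] = 0"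
    if "as \<noteq> []" "\<And>i a. (i, a) \<in> set as \<Longrightarrow> a \<in> nc_poly.subalgebra_gen (nc_var i) \<and> free_functional m a = 0"
      "distinct_adj (map fst as)" for as
    using that by force
  then show "nc_poly.free_vars (free_functional m) nc_var UNIV"
    unfolding nc_poly.free_vars_def free_functional_def by blast
qed

section \<open>Compactly supported measures and their moments\<close>

lemma compact_nonneg_prob_bounded_moments:
  assumes "compact_nonneg_prob \<mu>"
  shows "real_distribution \<mu>" "integrable \<mu> (\<lambda>x. x ^ n)" "\<exists>R. \<forall>n. (\<integral>x. \<bar>x\<bar> ^ n \<partial>\<mu>) \<le> R ^ n"
proof -
  obtain R where R: "AE x in \<mu>. 0 \<le> x \<and> x \<le> R" and \<mu>: "prob_space \<mu>" "sets \<mu> = sets borel"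
    using assms by (auto simp: compact_nonneg_prob_def)
  interpret prob_space \<mu> by fact
  show D: "real_distribution \<mu>"
    using \<mu> by (auto simp: real_distribution_def real_distribution_axioms_def dest: sets_eq_imp_space_eq)
  have [measurable_cong]: "sets \<mu> = sets borel" by fact
  have bound: "AE x in \<mu>. \<bar>x\<bar> ^ n \<le> R ^ n" for n
    using R by eventually_elim (auto intro: power_mono)
  show int: "integrable \<mu> (\<lambda>x. x ^ n)" for n
    by (rule integrable_const_bound[of _ "R ^ n"]) (use bound[of n] in \<open>auto simp: power_abs\<close>)
  have "(\<integral>x. \<bar>x\<bar> ^ n \<partial>\<mu>) \<le> R ^ n" for n
  proof -
    have "(\<integral>x. \<bar>x\<bar> ^ n \<partial>\<mu>) \<le> (\<integral>x. R ^ n \<partial>\<mu>)"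
      using int[of n] bound by (intro integral_mono_AE) (auto simp: power_abs[symmetric])
    then show ?thesis by (simp add: prob_space)
  qed
  then show "\<exists>R. \<forall>n. (\<integral>x. \<bar>x\<bar> ^ n \<partial>\<mu>) \<le> R ^ n" by blast
qed

text \<open>Bounded support makes the Taylor series of the characteristic function converge, and its coefficients
are the moments.\<close>

lemma compact_nonneg_prob_determined_by_moments:
  assumes "compact_nonneg_prob \<mu>" "compact_nonneg_prob \<nu>" "\<And>n. moment n \<mu> = moment n \<nu>"
  shows "\<mu> = \<nu>"
proof -
  have char_lim: "(\<lambda>n. \<Sum>k\<le>n. ((\<i> * t) ^ k / fact k) * moment k \<kappa>) \<longlonglongrightarrow> char \<kappa> t"
    if \<kappa>: "compact_nonneg_prob \<kappa>" for \<kappa> t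
  proof -
    obtain R where R: "\<And>n. (\<integral>x. \<bar>x\<bar> ^ n \<partial>\<kappa>) \<le> R ^ n"
      using compact_nonneg_prob_bounded_moments(3)[OF \<kappa>] by blast
    have "(\<lambda>n. (\<bar>t\<bar> * R) ^ n / fact n) \<longlonglongrightarrow> 0"
      using summable_exp[of "\<bar>t\<bar> * R"] by (intro summable_LIMSEQ_zero) (simp add: divide_inverse mult.commute)
    then have lim: "(\<lambda>n. 2 * ((\<bar>t\<bar> * R) ^ n / fact n)) \<longlonglongrightarrow> 0"
      by (rule tendsto_mult_right_zero)
    have "cmod (char \<kappa> t - (\<Sum>k\<le>n. ((\<i> * t) ^ k / fact k) * moment k \<kappa>)) \<le> 2 * ((\<bar>t\<bar> * R) ^ n / fact n)" for n
    proof -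
      have "cmod (char \<kappa> t - (\<Sum>k\<le>n. ((\<i> * t) ^ k / fact k) * moment k \<kappa>))
          \<le> (2 * \<bar>t\<bar> ^ n / fact n) * (\<integral>x. \<bar>x\<bar> ^ n \<partial>\<kappa>)"
        unfolding moment_def
        using compact_nonneg_prob_bounded_moments(1,2)[OF \<kappa>] by (intro real_distribution.char_approx1)
      also have "\<dots> \<le> (2 * \<bar>t\<bar> ^ n / fact n) * R ^ n"
        using R by (intro mult_left_mono) auto
      finally show ?thesis by (simp add: power_mult_distrib field_simps)
    qed
    then have "(\<lambda>n. char \<kappa> t - (\<Sum>k\<le>n. ((\<i> * t) ^ k / fact k) * moment k \<kappa>)) \<longlonglongrightarrow> 0"
      by (intro Lim_null_comparison[OF _ lim]) auto
    then have "(\<lambda>n. char \<kappa> t - (char \<kappa> t - (\<Sum>k\<le>n. ((\<i> * t) ^ k / fact k) * moment k \<kappa>))) \<longlonglongrightarrow> char \<kappa> t - 0"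
      by (intro tendsto_diff tendsto_const)
    then show ?thesis by simp
  qed
  have "char \<mu> t = char \<nu> t" for t
    using char_lim[OF assms(1)] char_lim[OF assms(2)] unfolding assms(3) by (rule LIMSEQ_unique)
  then show ?thesis
    using assms by (intro Levy_uniqueness) (auto simp: compact_nonneg_prob_bounded_moments)
qed

text \<open>Both terms are products of \<open>k\<close> numbers in the unit ball; the factors \<open>(j - i) / n\<close> and \<open>j / n\<close> differ by
at most \<open>k / n\<close>.\<close>

lemma falling_power_approx:
  fixes j n k :: nat
  assumes "j \<le> n" "k \<le> n" "n > 0"
  shows "\<bar>fact k * real (j choose k) / real n ^ k - (real j / real n) ^ k\<bar> \<le> (real k)\<^sup>2 / real n"
proof -
  have "fact k * real (j choose k) = (\<Prod>i=0..<k. real j - real i)"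
    by (simp add: binomial_gbinomial gbinomial_mult_fact)
  then have eq: "fact k * real (j choose k) / real n ^ k = (\<Prod>i=0..<k. (real j - real i) / real n)"
    by (simp add: prod_dividef)
  have "\<bar>(\<Prod>i=0..<k. (real j - real i) / real n) - (\<Prod>i=0..<k. real j / real n)\<bar>
      \<le> (\<Sum>i=0..<k. norm ((real j - real i) / real n - real j / real n))"
    unfolding real_norm_def[symmetric]
    by (rule norm_prod_diff) (use assms in \<open>auto simp: abs_if field_simps\<close>)
  also have "\<dots> = (\<Sum>i=0..<k. real i / real n)"
    using assms by (intro sum.cong refl) (simp add: diff_divide_distrib)
  also have "\<dots> \<le> (\<Sum>i=0..<k. real k / real n)"
    using assms by (intro sum_mono divide_right_mono) auto
  finally show ?thesis
    by (simp add: eq power2_eq_square)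
qed

text \<open>The number \<open>c j k\<close> plays the role of the integral of \<open>x\<^sup>j (1 - x)\<^sup>k\<close>. The discrete measure with mass
\<open>(n choose j) c j (n - j)\<close> at \<open>j / n\<close> is then a candidate for an approximation. Its factorial moments are exact
up to normalisation, hence its \<open>k\<close>-th moment tends to \<open>c k 0\<close>; a weak limit point exists by Helly's theorem.\<close>

theorem hausdorff_moment_problem:
  fixes c :: "nat \<Rightarrow> nat \<Rightarrow> real"
  assumes nonneg: "\<And>j k. c j k \<ge> 0" and rec: "\<And>j k. c j k = c (Suc j) k + c j (Suc k)" and c0: "c 0 0 = 1"
  obtains M where "real_distribution M" "AE x in M. 0 \<le> x \<and> x \<le> 1" "\<And>k. moment k M = c k 0"
proof -
  have expand: "(\<Sum>i\<le>n. real (n choose i) * c (a + i) (b + (n - i))) = c a b" for n a b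
  proof (induction n arbitrary: a b)
    case (Suc n)
    have "(\<Sum>i\<le>Suc n. real (Suc n choose i) * c (a + i) (b + (Suc n - i)))
        = c a (b + Suc n) + (\<Sum>i\<le>n. real (n choose i) * c (Suc a + i) (b + (n - i)))
          + (\<Sum>i\<le>n. real (n choose Suc i) * c (Suc a + i) (b + (n - i)))"
      by (subst sum.atMost_Suc_shift) (simp add: algebra_simps sum.distrib)
    also have "(\<Sum>i\<le>n. real (n choose i) * c (Suc a + i) (b + (n - i))) = c (Suc a) b"
      by (rule Suc.IH)
    also have "c a (b + Suc n) + c (Suc a) b + (\<Sum>i\<le>n. real (n choose Suc i) * c (Suc a + i) (b + (n - i)))
        = c (Suc a) b + (\<Sum>i\<le>Suc n. real (n choose i) * c (a + i) (b + (Suc n - i)))"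
      by (subst sum.atMost_Suc_shift) simp
    also have "(\<Sum>i\<le>Suc n. real (n choose i) * c (a + i) (b + (Suc n - i)))
        = (\<Sum>i\<le>n. real (n choose i) * c (a + i) (Suc b + (n - i)))"
      by (simp add: Suc_diff_le)
    also have "\<dots> = c a (Suc b)"
      by (rule Suc.IH)
    finally show ?case by (simp add: rec[of a b])
  qed simp

  define p where "p n j = (if j \<le> n then real (n choose j) * c j (n - j) else 0)" for n j
  have p_nonneg: "p n j \<ge> 0" for n j
    by (simp add: p_def nonneg)
  have p_sum: "(\<Sum>j\<le>n. p n j) = 1" for n
    using expand[of n 0 0] by (simp add: p_def c0)
  have p_choose: "(\<Sum>j\<le>n. p n j * real (j choose k)) = real (n choose k) * c k 0" if "k \<le> n" for n k
  proof -
    have "(\<Sum>j\<le>n. p n j * real (j choose k)) = (\<Sum>j\<in>{k..n}. p n j * real (j choose k))"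
      by (intro sum.mono_neutral_right) auto
    also have "\<dots> = (\<Sum>i\<le>n - k. p n (k + i) * real ((k + i) choose k))"
      by (rule sum.reindex_bij_witness[of _ "\<lambda>i. k + i" "\<lambda>j. j - k"]) (use that in auto)
    also have "\<dots> = (\<Sum>i\<le>n - k. real (n choose k) * (real ((n - k) choose i) * c (k + i) (0 + (n - k - i))))"
    proof (intro sum.cong refl)
      fix i assume "i \<in> {..n - k}"
      then have "(n choose (k + i)) * ((k + i) choose k) = (n choose k) * ((n - k) choose i)"
        using that choose_mult[of k "k + i" n] by simp
      then show "p n (k + i) * real ((k + i) choose k) = real (n choose k) * (real ((n - k) choose i) * c (k + i) (0 + (n - k - i)))"
        using \<open>i \<in> _\<close> that by (simp add: p_def mult.assoc[symmetric] of_nat_mult[symmetric] mult_ac del: of_nat_mult)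
    qed
    also have "\<dots> = real (n choose k) * c k 0"
      unfolding sum_distrib_left[symmetric] expand ..
    finally show ?thesis .
  qed
  have p_power: "\<bar>(\<Sum>j\<le>n. p n j * (real j / real n) ^ k) - c k 0\<bar> \<le> (1 + c k 0) * (real k)\<^sup>2 / real n"
    if n: "k \<le> n" "n > 0" for n k
  proof -
    define q where "q j = fact k * real (j choose k) / real n ^ k" for j
    have "(\<Sum>j\<le>n. p n j * q j) = (fact k / real n ^ k) * (\<Sum>j\<le>n. p n j * real (j choose k))"
      unfolding sum_distrib_left q_def by (intro sum.cong refl) (simp add: mult_ac)
    then have q_sum: "(\<Sum>j\<le>n. p n j * q j) = q n * c k 0"
      unfolding p_choose[OF n(1)] q_def by simp
    have "\<bar>(\<Sum>j\<le>n. p n j * (real j / real n) ^ k) - (\<Sum>j\<le>n. p n j * q j)\<bar>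
        \<le> (\<Sum>j\<le>n. p n j * ((real k)\<^sup>2 / real n))"
      unfolding sum_subtractf[symmetric] right_diff_distrib[symmetric]
    proof (rule order.trans[OF sum_abs], intro sum_mono)
      fix j assume "j \<in> {..n}"
      then show "\<bar>p n j * ((real j / real n) ^ k - q j)\<bar> \<le> p n j * ((real k)\<^sup>2 / real n)"
        using falling_power_approx[of j n k] n p_nonneg
        unfolding abs_mult q_def by (intro mult_mono) auto
    qed
    also have "\<dots> = (real k)\<^sup>2 / real n"
      unfolding sum_distrib_right[symmetric] p_sum by simp
    finally have 1: "\<bar>(\<Sum>j\<le>n. p n j * (real j / real n) ^ k) - q n * c k 0\<bar> \<le> (real k)\<^sup>2 / real n"
      unfolding q_sum .
    have "\<bar>q n - 1\<bar> \<le> (real k)\<^sup>2 / real n"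
      using falling_power_approx[of n n k] n by (simp add: q_def)
    then have "\<bar>q n - 1\<bar> * c k 0 \<le> (real k)\<^sup>2 / real n * c k 0"
      using nonneg by (rule mult_right_mono)
    moreover have "q n * c k 0 - c k 0 = (q n - 1) * c k 0"
      by (simp add: left_diff_distrib)
    ultimately have 2: "\<bar>q n * c k 0 - c k 0\<bar> \<le> c k 0 * (real k)\<^sup>2 / real n"
      using nonneg[of k 0] by (simp add: abs_mult mult.commute)
    have "(1 + c k 0) * (real k)\<^sup>2 / real n = (real k)\<^sup>2 / real n + c k 0 * (real k)\<^sup>2 / real n"
      by (simp add: add_divide_distrib distrib_right)
    then show ?thesis using 1 2 by linarith
  qed

  define P where "P n = embed_pmf (p n)" for n
  have pmf_P: "pmf (P n) j = p n j" for n j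
  proof -
    have "(\<integral>\<^sup>+ j. ennreal (p n j) \<partial>count_space UNIV) = (\<Sum>j\<le>n. ennreal (p n j))"
      by (rule nn_integral_count_space') (auto simp: p_def)
    also have "\<dots> = 1"
      using p_nonneg p_sum by (simp add: sum_ennreal)
    finally show ?thesis
      unfolding P_def using p_nonneg by (intro pmf_embed_pmf) auto
  qed
  have set_P: "set_pmf (P n) \<subseteq> {..n}" for n
    by (auto simp: set_pmf_iff pmf_P p_def split: if_splits)
  define \<mu> where "\<mu> n = distr (measure_pmf (P n)) borel (\<lambda>j. real j / real n)" for n
  have \<mu>_distribution: "real_distribution (\<mu> n)" for n
    by (simp add: real_distribution_def real_distribution_axioms_def \<mu>_def measure_pmf.prob_space_distr)
  have \<mu>_integral: "(\<integral>x. f x \<partial>\<mu> n) = (\<Sum>j\<le>n. p n j * f (real j / real n))"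
    if [measurable]: "f \<in> borel_measurable borel" for f :: "real \<Rightarrow> real" and n
  proof -
    have "(\<integral>x. f x \<partial>\<mu> n) = (\<integral>j. f (real j / real n) \<partial>measure_pmf (P n))"
      unfolding \<mu>_def by (rule integral_distr) auto
    also have "\<dots> = (\<Sum>j\<le>n. f (real j / real n) * pmf (P n) j)"
      by (rule integral_measure_pmf_real) (use set_P in auto)
    finally show ?thesis by (simp add: pmf_P mult.commute)
  qed
  have \<mu>_unit: "AE x in \<mu> n. 0 \<le> x \<and> x \<le> 1" for n
  proof -
    have "AE j in measure_pmf (P n). 0 \<le> real j / real n \<and> real j / real n \<le> 1"
      using set_P[of n] by (auto simp: AE_measure_pmf_iff divide_le_eq_1)
    then show ?thesis
      unfolding \<mu>_def by (subst AE_distr_iff) auto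
  qed
  have "tight \<mu>"
    unfolding tight_def
  proof (intro conjI allI impI \<mu>_distribution)
    fix e :: real assume "e > 0"
    have "measure (\<mu> n) {-1<..1} = 1" for n
    proof -
      interpret real_distribution "\<mu> n" by (rule \<mu>_distribution)
      show ?thesis
        using \<mu>_unit[of n] by (subst prob_eq_1) (auto elim: eventually_mono)
    qed
    then show "\<exists>a b. a < b \<and> (\<forall>n. 1 - e < measure (\<mu> n) {a<..b})"
      using \<open>e > 0\<close> by (intro exI[of _ "-1"] exI[of _ 1]) auto
  qed
  from tight_imp_convergent_subsubsequence[OF this, of id] obtain r M where
    r: "strict_mono (r :: nat \<Rightarrow> nat)" and M: "real_distribution M" "weak_conv_m (\<mu> \<circ> r) M"
    by (auto simp: strict_mono_id o_def id_def)
  interpret M: real_distribution M by fact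
  have lim: "(\<lambda>n. \<integral>x. f x \<partial>\<mu> (r n)) \<longlonglongrightarrow> (\<integral>x. f x \<partial>M)"
    if "\<And>x. isCont f x" "\<And>x. norm (f x) \<le> 1" for f :: "real \<Rightarrow> real"
    using weak_conv_imp_integral_bdd_continuous_conv[of "\<mu> \<circ> r" M f 1] that \<mu>_distribution M by auto

  \<comment> \<open>weak convergence only concerns bounded test functions, hence powers of the truncation to the unit interval\<close>
  define clamp :: "real \<Rightarrow> real" where "clamp x = max 0 (min 1 x)" for x
  have clamp: "isCont clamp x" "0 \<le> clamp x" "clamp x \<le> 1" "clamp \<in> borel_measurable borel" for x
    unfolding clamp_def[abs_def] by (auto intro!: continuous_intros)
  have clamp_id: "clamp x = x" if "0 \<le> x" "x \<le> 1" for x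
    using that by (simp add: clamp_def)
  have frac: "0 \<le> real j / real n" "real j / real n \<le> 1" if "j \<in> {..n}" for j n
    using that by (auto simp: divide_le_eq_1)

  define h where "h x = min 1 \<bar>x - clamp x\<bar>" for x
  have h_meas [measurable]: "h \<in> borel_measurable borel"
    using clamp(4) unfolding h_def[abs_def] by measurable
  have "(\<integral>x. h x \<partial>\<mu> n) = 0" for n
    unfolding \<mu>_integral[OF h_meas] using frac by (intro sum.neutral) (auto simp: h_def clamp_id)
  moreover have "isCont h x" "norm (h x) \<le> 1" for x
    unfolding h_def[abs_def] using clamp(1) by (auto intro!: continuous_intros)
  ultimately have "(\<integral>x. h x \<partial>M) = 0"
    using lim[of h] by (simp add: LIMSEQ_const_iff)
  moreover have "integrable M h"
    by (rule M.integrable_const_bound[of _ 1]) (auto simp: h_def)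
  ultimately have "AE x in M. h x = 0"
    by (subst (asm) integral_nonneg_eq_0_iff_AE) (auto simp: h_def)
  then have M_unit: "AE x in M. 0 \<le> x \<and> x \<le> 1"
    by eventually_elim (auto simp: h_def clamp_def min_def max_def split: if_splits)

  have "moment k M = c k 0" for k
  proof -
    have ck: "isCont (\<lambda>x. clamp x ^ k) x" "norm (clamp x ^ k) \<le> 1" for x
      using clamp by (auto intro!: continuous_intros power_le_one)
    have ck_meas: "(\<lambda>x. clamp x ^ k) \<in> borel_measurable borel"
      using clamp(4) by measurable
    have "(\<integral>x. clamp x ^ k \<partial>\<mu> n) = (\<Sum>j\<le>n. p n j * (real j / real n) ^ k)" for n
      unfolding \<mu>_integral[OF ck_meas] using frac by (intro sum.cong refl) (auto simp: clamp_id)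
    then have bound: "norm ((\<integral>x. clamp x ^ k \<partial>\<mu> n) - c k 0) \<le> (1 + c k 0) * (real k)\<^sup>2 / real n" if "n \<ge> Suc k" for n
      using p_power[of k n] that by simp
    have "(\<lambda>n. (\<integral>x. clamp x ^ k \<partial>\<mu> n) - c k 0) \<longlonglongrightarrow> 0"
    proof (rule Lim_null_comparison)
      show "\<forall>\<^sub>F n in sequentially. norm ((\<integral>x. clamp x ^ k \<partial>\<mu> n) - c k 0) \<le> (1 + c k 0) * (real k)\<^sup>2 / real n"
        using bound by (auto simp: eventually_sequentially)
      show "(\<lambda>n. (1 + c k 0) * (real k)\<^sup>2 / real n) \<longlonglongrightarrow> 0"
        by (rule lim_const_over_n)
    qed
    then have "(\<lambda>n. \<integral>x. clamp x ^ k \<partial>\<mu> n) \<longlonglongrightarrow> c k 0"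
      by (simp add: LIM_zero_iff)
    then have "(\<lambda>n. \<integral>x. clamp x ^ k \<partial>\<mu> (r n)) \<longlonglongrightarrow> c k 0"
      using LIMSEQ_subseq_LIMSEQ[OF _ r] by (auto simp: o_def)
    with lim[of "\<lambda>x. clamp x ^ k"] ck have "(\<integral>x. clamp x ^ k \<partial>M) = c k 0"
      by (blast intro: LIMSEQ_unique)
    moreover have "(\<integral>x. clamp x ^ k \<partial>M) = moment k M"
      unfolding moment_def using M_unit clamp(4) by (intro integral_cong_AE) (auto simp: clamp_id elim: eventually_mono)
    ultimately show ?thesis by simp
  qed
  with M(1) M_unit show thesis by (rule that)
qed

section \<open>Vacuum moments of bounded positive operators\<close>

definition fin_supp :: "('a \<Rightarrow> real) \<Rightarrow> bool" where
  "fin_supp u \<longleftrightarrow> finite {x. u x \<noteq> 0}"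

definition inner_fs :: "('a \<Rightarrow> real) \<Rightarrow> ('a \<Rightarrow> real) \<Rightarrow> real" where
  "inner_fs u v = (\<Sum>x | u x \<noteq> 0. u x * v x)"

lemma inner_fs_superset:
  assumes "finite S" "fin_supp u" "\<And>x. u x \<noteq> 0 \<Longrightarrow> v x \<noteq> 0 \<Longrightarrow> x \<in> S"
  shows "inner_fs u v = (\<Sum>x\<in>S. u x * v x)"
  unfolding inner_fs_def using assms by (intro sum.mono_neutral_cong) (auto simp: fin_supp_def)

lemma inner_fs_commute:
  assumes "fin_supp u" "fin_supp v"
  shows "inner_fs u v = inner_fs v u"
  using inner_fs_superset[of "{x. u x \<noteq> 0}" v u] assms by (simp add: fin_supp_def inner_fs_def mult.commute)

lemma inner_fs_self_nonneg: "inner_fs u u \<ge> 0"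
  unfolding inner_fs_def by (intro sum_nonneg) simp

lemma inner_fs_comb_right: "inner_fs u (\<lambda>x. a * v x + b * w x) = a * inner_fs u v + b * inner_fs u w"
  unfolding inner_fs_def by (simp add: distrib_left sum.distrib sum_distrib_left mult_ac)

lemma fin_supp_comb:
  assumes "fin_supp v" "fin_supp w"
  shows "fin_supp (\<lambda>x. a * v x + b * w x)"
proof -
  have "{x. a * v x + b * w x \<noteq> 0} \<subseteq> {x. v x \<noteq> 0} \<union> {x. w x \<noteq> 0}" by auto
  then show ?thesis
    using assms unfolding fin_supp_def by (meson finite_Un finite_subset)
qed

lemma inner_fs_comb_left:
  assumes "fin_supp u" "fin_supp v" "fin_supp w"
  shows "inner_fs (\<lambda>x. a * v x + b * w x) u = a * inner_fs v u + b * inner_fs w u"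
  using assms by (simp add: inner_fs_commute[of _ u] fin_supp_comb inner_fs_comb_right)

definition push :: "'a \<Rightarrow> ('a list \<Rightarrow> real) \<Rightarrow> 'a list \<Rightarrow> real" where
  "push c u w = (case w of [] \<Rightarrow> 0 | x # v \<Rightarrow> if x = c then u v else 0)"

definition pop :: "'a \<Rightarrow> ('a list \<Rightarrow> real) \<Rightarrow> 'a list \<Rightarrow> real" where
  "pop c u w = u (c # w)"

lemma push_support: "{w. push c u w \<noteq> 0} = (#) c ` {w. u w \<noteq> 0}"
proof (rule set_eqI)
  fix w show "w \<in> {w. push c u w \<noteq> 0} \<longleftrightarrow> w \<in> (#) c ` {w. u w \<noteq> 0}"
    by (cases w) (auto simp: push_def)
qed

lemma fin_supp_push: "fin_supp u \<Longrightarrow> fin_supp (push c u)"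
  by (simp add: fin_supp_def push_support)

lemma fin_supp_pop:
  assumes "fin_supp u"
  shows "fin_supp (pop c u)"
proof -
  have "{w. pop c u w \<noteq> 0} = (#) c -` {w. u w \<noteq> 0}"
    by (auto simp: pop_def)
  moreover have "finite ((#) c -` {w. u w \<noteq> 0})"
    using assms by (intro finite_vimageI) (auto simp: fin_supp_def)
  ultimately show ?thesis
    by (simp add: fin_supp_def)
qed

lemma inner_fs_push_left: "inner_fs (push c u) v = inner_fs u (pop c v)"
  unfolding inner_fs_def push_support by (simp add: sum.reindex push_def pop_def)

lemma inner_fs_pop_left:
  assumes "fin_supp u" "fin_supp v"
  shows "inner_fs (pop c u) v = inner_fs u (push c v)"
  using assms by (simp add: inner_fs_commute[of _ v] inner_fs_commute[of u] fin_supp_pop fin_supp_push inner_fs_push_left)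

lemma inner_fs_push_self: "inner_fs (push c u) (push c u) = inner_fs u u"
proof -
  have "pop c (push c u) = u"
    by (simp add: fun_eq_iff pop_def push_def)
  then show ?thesis by (simp add: inner_fs_push_left)
qed

lemma inner_fs_pop_self:
  assumes "fin_supp u"
  shows "inner_fs (pop c u) (pop c u) \<le> inner_fs u u"
proof -
  have "inner_fs (pop c u) (pop c u) = inner_fs u (push c (pop c u))"
    using assms by (simp add: inner_fs_pop_left fin_supp_pop)
  also have "\<dots> \<le> inner_fs u u"
    unfolding inner_fs_def by (intro sum_mono) (auto simp: push_def pop_def split: list.splits)
  finally show ?thesis .
qed

lemma inner_fs_sum_self:
  assumes "fin_supp v" "fin_supp w"
  shows "inner_fs (\<lambda>x. a * v x + b * w x) (\<lambda>x. a * v x + b * w x) \<le> 2 * a\<^sup>2 * inner_fs v v + 2 * b\<^sup>2 * inner_fs w w"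
proof -
  let ?S = "{x. v x \<noteq> 0} \<union> {x. w x \<noteq> 0}"
  have S: "finite ?S" using assms by (simp add: fin_supp_def)
  have "inner_fs (\<lambda>x. a * v x + b * w x) (\<lambda>x. a * v x + b * w x) = (\<Sum>x\<in>?S. (a * v x + b * w x) * (a * v x + b * w x))"
    using S assms by (intro inner_fs_superset fin_supp_comb) auto
  also have "\<dots> \<le> (\<Sum>x\<in>?S. 2 * a\<^sup>2 * (v x * v x) + 2 * b\<^sup>2 * (w x * w x))"
  proof (intro sum_mono)
    fix x
    have "0 \<le> (a * v x - b * w x)\<^sup>2" by simp
    then show "(a * v x + b * w x) * (a * v x + b * w x) \<le> 2 * a\<^sup>2 * (v x * v x) + 2 * b\<^sup>2 * (w x * w x)"
      by (simp add: power2_eq_square algebra_simps)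
  qed
  also have "\<dots> = 2 * a\<^sup>2 * inner_fs v v + 2 * b\<^sup>2 * inner_fs w w"
    using S assms by (simp add: inner_fs_superset[of ?S] sum.distrib sum_distrib_left)
  finally show ?thesis .
qed

text \<open>Let \<open>D = R - T\<close>. Since \<open>T\<close> and \<open>D\<close> commute and are symmetric and positive, \<open>\<langle>\<Omega>, T\<^sup>j D\<^sup>k \<Omega>\<rangle>\<close> is nonnegative: half
of each power can be moved to the left, which leaves a vector \<open>v\<close> and one of \<open>1\<close>, \<open>T\<close>, \<open>D\<close>, \<open>T D\<close> between two
copies of \<open>v\<close>. The last of these is positive because \<open>R T D = T D T + D T D\<close>. These numbers, scaled by
\<open>R\<^bsup>-j-k\<^esup>\<close>, are the input for Hausdorff's moment problem.\<close>

theorem positive_operator_moments: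
  fixes T :: "('a \<Rightarrow> real) \<Rightarrow> 'a \<Rightarrow> real"
  assumes fin: "\<And>u. fin_supp u \<Longrightarrow> fin_supp (T u)"
    and lin: "\<And>a b u v. T (\<lambda>x. a * u x + b * v x) = (\<lambda>x. a * T u x + b * T v x)"
    and sym: "\<And>u v. fin_supp u \<Longrightarrow> fin_supp v \<Longrightarrow> inner_fs (T u) v = inner_fs u (T v)"
    and pos: "\<And>u. fin_supp u \<Longrightarrow> 0 \<le> inner_fs u (T u)"
    and bound: "\<And>u. fin_supp u \<Longrightarrow> inner_fs u (T u) \<le> R * inner_fs u u" and R: "R > 0"
    and vac: "fin_supp \<Omega>" "inner_fs \<Omega> \<Omega> = 1"
  obtains M where "compact_nonneg_prob M" "\<And>k. moment k M = inner_fs \<Omega> ((T ^^ k) \<Omega>)"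
proof -
  define D where "D u = (\<lambda>x. R * u x + (- 1) * T u x)" for u
  have fin_D: "fin_supp (D u)" if "fin_supp u" for u
    unfolding D_def by (intro fin_supp_comb fin that)
  have comm: "T (D u) = D (T u)" for u
    by (simp add: D_def lin[of R _ "-1", simplified])
  have fin_pow: "fin_supp ((T ^^ j) u)" "fin_supp ((D ^^ j) u)" if "fin_supp u" for u j
    by (induction j) (auto intro: fin fin_D that)
  have comm_pow: "(T ^^ j) (D u) = D ((T ^^ j) u)" "T ((D ^^ j) u) = (D ^^ j) (T u)" for u j
    by (induction j arbitrary: u) (auto simp: comm)
  have sym_D: "inner_fs (D u) v = inner_fs u (D v)" if "fin_supp u" "fin_supp v" for u v
    unfolding D_def using that by (simp only: inner_fs_comb_left inner_fs_comb_right fin sym)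
  have sym_pow: "inner_fs ((T ^^ j) u) v = inner_fs u ((T ^^ j) v)" "inner_fs ((D ^^ j) u) v = inner_fs u ((D ^^ j) v)"
    if "fin_supp u" "fin_supp v" for u v j
    using that by (induction j arbitrary: v) (simp_all add: sym sym_D fin fin_D fin_pow funpow_swap1[symmetric])
  have pos_D: "0 \<le> inner_fs u (D u)" if "fin_supp u" for u
    using bound[OF that] unfolding D_def inner_fs_comb_right by simp
  have pos_TD: "0 \<le> inner_fs u (T (D u))" if u: "fin_supp u" for u
  proof -
    have "(\<lambda>x. R * T (D u) x + 0 * u x) = (\<lambda>x. 1 * T (D (T u)) x + 1 * D (T (D u)) x)"
      unfolding comm unfolding D_def by (simp add: lin[of R _ "-1", simplified])
    then have "R * inner_fs u (T (D u)) = inner_fs u (T (D (T u))) + inner_fs u (D (T (D u)))"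
      using inner_fs_comb_right[of u R "T (D u)" 0 u] inner_fs_comb_right[of u 1 "T (D (T u))" 1 "D (T (D u))"]
      by simp
    also have "\<dots> = inner_fs (T u) (D (T u)) + inner_fs (D u) (T (D u))"
      using u by (simp add: sym sym_D fin fin_D)
    also have "\<dots> \<ge> 0"
      using u by (intro add_nonneg_nonneg pos pos_D fin fin_D)
    finally show ?thesis
      using R by (simp add: zero_le_mult_iff)
  qed
  define c where "c j k = inner_fs \<Omega> ((T ^^ j) ((D ^^ k) \<Omega>)) / R ^ (j + k)" for j k
  have c_nonneg: "c j k \<ge> 0" for j k
  proof -
    define v where "v = (T ^^ (j div 2)) ((D ^^ (k div 2)) \<Omega>)"
    have v: "fin_supp v" unfolding v_def by (intro fin_pow vac)
    have TD: "(T ^^ a) ((D ^^ b) u) = (D ^^ b) ((T ^^ a) u)" for a b u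
      by (induction a) (simp_all add: comm_pow)
    have "(T ^^ j) ((D ^^ k) \<Omega>) = (T ^^ (j div 2 + (j mod 2 + j div 2))) ((D ^^ (k div 2 + (k mod 2 + k div 2))) \<Omega>)"
      by (intro arg_cong2[where f = "\<lambda>j k. (T ^^ j) ((D ^^ k) \<Omega>)"]) presburger+
    also have "\<dots> = (D ^^ (k div 2)) ((T ^^ (j div 2)) ((T ^^ (j mod 2)) ((D ^^ (k mod 2)) v)))"
      by (simp add: funpow_add v_def TD)
    finally have "inner_fs \<Omega> ((T ^^ j) ((D ^^ k) \<Omega>)) = inner_fs \<Omega> ((D ^^ (k div 2)) ((T ^^ (j div 2)) ((T ^^ (j mod 2)) ((D ^^ (k mod 2)) v))))"
      by (rule arg_cong)
    also have "\<dots> = inner_fs v ((T ^^ (j mod 2)) ((D ^^ (k mod 2)) v))"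
      unfolding v_def by (simp add: sym_pow[symmetric] fin_pow vac)
    also have "\<dots> \<ge> 0"
      using pos[OF v] pos_D[OF v] pos_TD[OF v] inner_fs_self_nonneg[of v]
      by (cases "even j"; cases "even k") (simp_all add: odd_iff_mod_2_eq_one even_iff_mod_2_eq_zero)
    finally show ?thesis
      using R by (simp add: c_def)
  qed
  have c_rec: "c j k = c (Suc j) k + c j (Suc k)" for j k
  proof -
    have "(T ^^ j) ((D ^^ Suc k) \<Omega>) = D ((T ^^ j) ((D ^^ k) \<Omega>))"
      by (simp add: comm_pow(1))
    also have "\<dots> = (\<lambda>x. R * (T ^^ j) ((D ^^ k) \<Omega>) x + (- 1) * (T ^^ Suc j) ((D ^^ k) \<Omega>) x)"
      by (simp add: D_def)
    finally have "(T ^^ j) ((D ^^ Suc k) \<Omega>) = (\<lambda>x. R * (T ^^ j) ((D ^^ k) \<Omega>) x + (- 1) * (T ^^ Suc j) ((D ^^ k) \<Omega>) x)" .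
    then have "inner_fs \<Omega> ((T ^^ j) ((D ^^ Suc k) \<Omega>))
        = R * inner_fs \<Omega> ((T ^^ j) ((D ^^ k) \<Omega>)) - inner_fs \<Omega> ((T ^^ Suc j) ((D ^^ k) \<Omega>))"
      by (simp only: inner_fs_comb_right)
    then show ?thesis
      using R by (simp add: c_def field_simps del: funpow.simps)
  qed
  have "c 0 0 = 1" using vac by (simp add: c_def)
  from hausdorff_moment_problem[OF c_nonneg c_rec this] obtain N where
    N: "real_distribution N" "AE x in N. 0 \<le> x \<and> x \<le> 1" "\<And>k. moment k N = c k 0" by blast
  interpret N: real_distribution N by fact
  define M where "M = distr N borel (\<lambda>x. R * x)"
  have "AE x in M. 0 \<le> x \<and> x \<le> R"
    unfolding M_def using N(2) R
    by (subst AE_distr_iff) (auto elim!: eventually_mono)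
  then have "compact_nonneg_prob M"
    unfolding compact_nonneg_prob_def by (auto simp: M_def intro!: N.prob_space_distr)
  moreover have "moment k M = inner_fs \<Omega> ((T ^^ k) \<Omega>)" for k
  proof -
    have "moment k M = (\<integral>x. (R * x) ^ k \<partial>N)"
      unfolding moment_def M_def by (rule integral_distr) auto
    also have "\<dots> = R ^ k * moment k N"
      unfolding moment_def power_mult_distrib by simp
    also have "\<dots> = inner_fs \<Omega> ((T ^^ k) \<Omega>)"
      using R by (simp add: N(3) c_def)
    finally show ?thesis .
  qed
  ultimately show thesis by (rule that)
qed


text \<open>Push a letter \<open>c\<close> with amplitude \<open>a\<close> or pop a letter \<open>d\<close> with amplitude \<open>b\<close>. The adjoint exchanges the roles of
\<open>c\<close> and \<open>d\<close>.\<close>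

definition hop :: "'a \<Rightarrow> 'a \<Rightarrow> real \<Rightarrow> real \<Rightarrow> ('a list \<Rightarrow> real) \<Rightarrow> 'a list \<Rightarrow> real" where
  "hop c d a b u = (\<lambda>w. a * push c u w + b * pop d u w)"

lemma fin_supp_hop: "fin_supp u \<Longrightarrow> fin_supp (hop c d a b u)"
  unfolding hop_def by (intro fin_supp_comb fin_supp_push fin_supp_pop)

lemma hop_comb: "hop c d a b (\<lambda>w. r * u w + s * v w) = (\<lambda>w. r * hop c d a b u w + s * hop c d a b v w)"
  by (auto simp: hop_def push_def pop_def fun_eq_iff algebra_simps split: list.splits)

lemma hop_adjoint:
  assumes "fin_supp u" "fin_supp v"
  shows "inner_fs (hop c d a b u) v = inner_fs u (hop d c b a v)"
  unfolding hop_def using assms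
  by (simp add: inner_fs_comb_left fin_supp_push fin_supp_pop inner_fs_comb_right inner_fs_push_left inner_fs_pop_left)

lemma hop_bound:
  assumes "fin_supp u"
  shows "inner_fs (hop c d a b u) (hop c d a b u) \<le> 2 * (a\<^sup>2 + b\<^sup>2) * inner_fs u u"
proof -
  have "inner_fs (hop c d a b u) (hop c d a b u) \<le> 2 * a\<^sup>2 * inner_fs (push c u) (push c u) + 2 * b\<^sup>2 * inner_fs (pop d u) (pop d u)"
    unfolding hop_def using assms by (intro inner_fs_sum_self fin_supp_push fin_supp_pop)
  also have "\<dots> \<le> 2 * a\<^sup>2 * inner_fs u u + 2 * b\<^sup>2 * inner_fs u u"
    using assms by (intro add_mono mult_left_mono) (auto simp: inner_fs_push_self inner_fs_pop_self)
  finally show ?thesis by (simp add: algebra_simps)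
qed

text \<open>Level \<open>j\<close> has two letters, \<open>(True, j)\<close> and \<open>(False, j)\<close>. The operator \<open>C\<^sub>j\<close> pushes the former with amplitude
\<open>sqrt s\<^sub>j\<^sub>+\<^sub>1\<close> and pops the latter with amplitude \<open>sqrt s\<^sub>j\<close>; in free probability this is known as a generalized
circular element. The function \<open>forward\<close> is \<open>S = C\<^sub>n\<^sub>-\<^sub>1 \<cdots> C\<^sub>0\<close> and \<open>backward\<close> is \<open>S\<^sup>*\<close>.\<close>

context
  fixes s :: "nat \<Rightarrow> real"
begin

fun forward :: "nat \<Rightarrow> ((bool \<times> nat) list \<Rightarrow> real) \<Rightarrow> (bool \<times> nat) list \<Rightarrow> real" where
  "forward 0 u = u"
| "forward (Suc j) u = hop (True, j) (False, j) (sqrt (s (Suc j))) (sqrt (s j)) (forward j u)"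

fun backward :: "nat \<Rightarrow> ((bool \<times> nat) list \<Rightarrow> real) \<Rightarrow> (bool \<times> nat) list \<Rightarrow> real" where
  "backward 0 u = u"
| "backward (Suc j) u = backward j (hop (False, j) (True, j) (sqrt (s j)) (sqrt (s (Suc j))) u)"

lemma fin_supp_forward: "fin_supp u \<Longrightarrow> fin_supp (forward n u)"
  by (induction n) (simp_all add: fin_supp_hop)

lemma fin_supp_backward: "fin_supp u \<Longrightarrow> fin_supp (backward n u)"
  by (induction n arbitrary: u) (simp_all add: fin_supp_hop)

lemma forward_comb: "forward n (\<lambda>w. a * u w + b * v w) = (\<lambda>w. a * forward n u w + b * forward n v w)"
  by (induction n) (simp_all add: hop_comb)

lemma backward_comb: "backward n (\<lambda>w. a * u w + b * v w) = (\<lambda>w. a * backward n u w + b * backward n v w)"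
  by (induction n arbitrary: u v) (simp_all add: hop_comb)

lemma forward_adjoint: "fin_supp u \<Longrightarrow> fin_supp v \<Longrightarrow> inner_fs (forward n u) v = inner_fs u (backward n v)"
  by (induction n arbitrary: v) (simp_all add: hop_adjoint fin_supp_hop fin_supp_forward)

lemma forward_bound: "\<exists>K>0. \<forall>u. fin_supp u \<longrightarrow> inner_fs (forward n u) (forward n u) \<le> K * inner_fs u u"
proof (induction n)
  case 0
  then show ?case by (intro exI[of _ 1]) simp
next
  case (Suc n)
  then obtain K where K: "K > 0" "\<And>u. fin_supp u \<Longrightarrow> inner_fs (forward n u) (forward n u) \<le> K * inner_fs u u"
    by blast
  define L where "L = 2 * ((sqrt (s (Suc n)))\<^sup>2 + (sqrt (s n))\<^sup>2)"
  have "L \<ge> 0" by (simp add: L_def)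
  show ?case
  proof (intro exI[of _ "L * K + 1"] conjI allI impI)
    show "L * K + 1 > 0" using \<open>L \<ge> 0\<close> K(1) by (simp add: add_nonneg_pos)
    fix u :: "(bool \<times> nat) list \<Rightarrow> real" assume u: "fin_supp u"
    have "inner_fs (forward (Suc n) u) (forward (Suc n) u) \<le> L * inner_fs (forward n u) (forward n u)"
      unfolding L_def forward.simps using u by (intro hop_bound fin_supp_forward)
    also have "\<dots> \<le> L * (K * inner_fs u u)"
      using K(2)[OF u] \<open>L \<ge> 0\<close> by (rule mult_left_mono)
    also have "\<dots> \<le> (L * K + 1) * inner_fs u u"
      using inner_fs_self_nonneg[of u] by (simp add: algebra_simps)
    finally show "inner_fs (forward (Suc n) u) (forward (Suc n) u) \<le> (L * K + 1) * inner_fs u u" .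
  qed
qed

definition vacuum :: "(bool \<times> nat) list \<Rightarrow> real" where
  "vacuum w = (if w = [] then 1 else 0)"

lemma forward_backward_moments:
  obtains M where "compact_nonneg_prob M" "\<And>k. moment k M = (((\<lambda>u. backward p (forward p u)) ^^ k) vacuum) []"
proof -
  obtain K where K: "K > 0" "\<And>u. fin_supp u \<Longrightarrow> inner_fs (forward p u) (forward p u) \<le> K * inner_fs u u"
    using forward_bound[of p] by blast
  have vac: "fin_supp vacuum" "inner_fs vacuum u = u []" for u
    by (simp_all add: fin_supp_def vacuum_def inner_fs_def)
  show thesis
  proof (rule positive_operator_moments[of "\<lambda>u. backward p (forward p u)" K vacuum])
    fix u v :: "(bool \<times> nat) list \<Rightarrow> real"
    assume u: "fin_supp u"
    show "fin_supp (backward p (forward p u))"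
      by (intro fin_supp_backward fin_supp_forward u)
    have *: "inner_fs u (backward p (forward p u)) = inner_fs (forward p u) (forward p u)"
      using u by (simp add: forward_adjoint fin_supp_forward)
    show "0 \<le> inner_fs u (backward p (forward p u))" "inner_fs u (backward p (forward p u)) \<le> K * inner_fs u u"
      unfolding * using K(2)[OF u] inner_fs_self_nonneg by auto
    assume v: "fin_supp v"
    have "inner_fs (backward p (forward p u)) v = inner_fs v (backward p (forward p u))"
      using u v by (intro inner_fs_commute fin_supp_backward fin_supp_forward)
    also have "\<dots> = inner_fs (forward p v) (forward p u)"
      using u v by (simp add: forward_adjoint fin_supp_forward)
    also have "\<dots> = inner_fs (forward p u) (forward p v)"
      using u v by (intro inner_fs_commute fin_supp_forward)
    also have "\<dots> = inner_fs u (backward p (forward p v))"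
      using u v by (simp add: forward_adjoint fin_supp_forward)
    finally show "inner_fs (backward p (forward p u)) v = inner_fs u (backward p (forward p v))" .
  next
    fix M assume "compact_nonneg_prob M" "\<And>k. moment k M = inner_fs vacuum (((\<lambda>u. backward p (forward p u)) ^^ k) vacuum)"
    then show thesis by (intro that[of M]) (simp_all add: vac(2))
  qed (simp_all add: forward_comb backward_comb K(1) vac, simp add: vacuum_def)
qed

end

section \<open>A Fock space model of the Fuss-Narayana numbers\<close>

text \<open>The generating functions, by the number of applications of \<open>S\<^sup>* S\<close>, of the amplitudes of the walks from the empty
stack to a given stack. A walk alternately climbs the levels from \<open>0\<close> to \<open>p\<close>, applying \<open>C\<^sub>0, \<dots>, C\<^sub>p\<^sub>-\<^sub>1\<close>
(direction \<open>True\<close>), and descends by the adjoints (direction \<open>False\<close>); the value at direction \<open>b\<close> and level \<open>k\<close>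
concerns the walks that stop there. A walk decomposes at the last visits of the lower parts of the
stack. Having pushed \<open>(True, j)\<close> it is at level \<open>j + 1\<close> going up, and each later return to the
same stack height happens at the same level, with alternating directions. The parameter \<open>g k\<close> stands for
the generating function of all returns with unchanged direction, and \<open>F k\<close> and \<open>B k\<close> stand for those of a
single excursion which turns upward into downward and downward into upward motion.\<close>

primrec stack_series :: "nat \<Rightarrow> (nat \<Rightarrow> real) \<Rightarrow> (nat \<Rightarrow> real fps) \<Rightarrow> (nat \<Rightarrow> real fps) \<Rightarrow> (nat \<Rightarrow> real fps)
    \<Rightarrow> (bool \<times> nat) list \<Rightarrow> bool \<Rightarrow> nat \<Rightarrow> real fps" where
  "stack_series p s F B g [] = (\<lambda>b k. if k = 0 then (if b then 1 else F 0) * g 0 else 0)"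
| "stack_series p s F B g (x # w) = (\<lambda>b k. case x of (up, j) \<Rightarrow>
     if j \<ge> p then 0
     else if up then if k = Suc j then fps_const (sqrt (s k)) * (if b then 1 else F k) * g k * stack_series p s F B g w True j else 0
     else if k = j then fps_const (sqrt (s k)) * (if b then B k else 1) * g k * stack_series p s F B g w False (Suc j) else 0)"

text \<open>With \<open>Q\<^sub>i = s\<^sub>i + M\<close> the generating functions of the excursions are \<open>F\<^sub>k = Q\<^sub>k\<^sub>+\<^sub>1 \<cdots> Q\<^sub>p\<close>,
\<open>B\<^sub>k = z Q\<^sub>0 \<cdots> Q\<^sub>k\<^sub>-\<^sub>1\<close> and \<open>g\<^sub>k = Q\<^sub>k / s\<^sub>k\<close>. The functional equation of \<open>M\<close> says \<open>B\<^sub>k Q\<^sub>k F\<^sub>k = M\<close>, which is the renewal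
equation \<open>g\<^sub>k = 1 + B\<^sub>k F\<^sub>k g\<^sub>k\<close>. With these values, the series \<open>r\<close> solve the equations of one step up, one step
down, the turn at level \<open>p\<close> and the return to level \<open>0\<close>. The iterates of \<open>S\<^sup>* S\<close> on the empty stack are
determined by the same equations, so they are the coefficients of \<open>r\<close>.\<close>

lemma fock_moments:
  fixes s :: "nat \<Rightarrow> real" and M :: "real fps"
  assumes p: "p \<ge> 1" and s: "\<And>i. i \<le> p \<Longrightarrow> s i > 0"
    and M: "M = fps_X * (\<Prod>i=0..p. fps_const (s i) + M)"
  shows "(((\<lambda>u. backward s p (forward s p u)) ^^ k) vacuum) [] = fps_nth (1 + fps_const (1 / s 0) * M) k"
proof -
  define Q where "Q i = fps_const (s i) + M" for i
  define F where "F j = (\<Prod>i=Suc j..p. Q i)" for j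
  define B where "B j = fps_X * (\<Prod>i<j. Q i)" for j
  define g where "g j = fps_const (1 / s j) * Q j" for j
  define r where "r = stack_series p s F B g"
  have BQF: "B j * Q j * F j = M" if "j \<le> p" for j
  proof -
    have "(\<Prod>i=0..p. Q i) = (\<Prod>i<j. Q i) * (\<Prod>i=j..p. Q i)"
      by (subst prod.union_disjoint[symmetric]) (use that in \<open>auto intro!: prod.cong\<close>)
    also have "(\<Prod>i=j..p. Q i) = Q j * F j"
      unfolding F_def by (rule prod.atLeast_Suc_atMost[OF that])
    finally show ?thesis
      using M by (simp add: B_def Q_def mult.assoc)
  qed
  have const_sqrt: "fps_const (sqrt (s j)) * (fps_const (sqrt (s j)) * h) = fps_const (s j) * h" if "j \<le> p" for j h
    using s[OF that] by (simp flip: mult.assoc)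
  have sg: "fps_const (s j) * g j = Q j" if "j \<le> p" for j
    using s[OF that] unfolding g_def by (simp flip: mult.assoc)
  have g: "g j = 1 + B j * (F j * g j)" if "j \<le> p" for j
  proof -
    have "g j = fps_const (1 / s j) * (fps_const (s j) + B j * Q j * F j)"
      unfolding BQF[OF that] by (simp add: g_def Q_def)
    also have "\<dots> = 1 + B j * (F j * g j)"
      using s[OF that] unfolding g_def by (simp add: distrib_left mult_ac)
    finally show ?thesis .
  qed
  have B_Suc: "B (Suc j) = Q j * B j" for j
    by (simp add: B_def mult_ac)
  have F_Suc: "F j = Q (Suc j) * F (Suc j)" if "j < p" for j
    unfolding F_def using that by (intro prod.atLeast_Suc_atMost) auto

  \<comment> \<open>a stack is reached going up at level \<open>j + 1\<close> by pushing \<open>(True, j)\<close> last or by popping \<open>(False, j)\<close>\<close>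
  have up: "r w True (Suc j) = fps_const (sqrt (s (Suc j))) * (case w of [] \<Rightarrow> 0 | x # v \<Rightarrow> if x = (True, j) then r v True j else 0)
      + fps_const (sqrt (s j)) * r ((False, j) # w) True j" if "j < p" for j w
  proof -
    have "fps_const (sqrt (s j)) * r ((False, j) # w) True j = B (Suc j) * r w False (Suc j)"
      using that by (simp add: r_def B_Suc sg[symmetric] const_sqrt mult.assoc)
    moreover have "r w True (Suc j) = fps_const (sqrt (s (Suc j))) * (case w of [] \<Rightarrow> 0 | x # v \<Rightarrow> if x = (True, j) then r v True j else 0)
        + B (Suc j) * r w False (Suc j)"
    proof (cases w)
      case Nil
      then show ?thesis by (simp add: r_def)
    next
      case (Cons x v)
      obtain b i where x: "x = (b, i)" by (cases x)
      let ?c = "fps_const (sqrt (s (Suc j)))"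
      let ?h = "stack_series p s F B g v True j"
      have "?c * g (Suc j) * ?h = ?c * ?h + B (Suc j) * (?c * F (Suc j) * g (Suc j) * ?h)"
        by (subst g) (use that in \<open>simp_all add: algebra_simps\<close>)
      then show ?thesis
        using that by (auto simp: Cons x r_def mult_ac)
    qed
    ultimately show ?thesis by simp
  qed
  have down: "r w False j = fps_const (sqrt (s j)) * (case w of [] \<Rightarrow> 0 | x # v \<Rightarrow> if x = (False, j) then r v False (Suc j) else 0)
      + fps_const (sqrt (s (Suc j))) * r ((True, j) # w) False (Suc j)" if "j < p" for j w
  proof -
    have "fps_const (sqrt (s (Suc j))) * r ((True, j) # w) False (Suc j) = F j * r w True j"
      using that by (simp add: r_def F_Suc sg[symmetric] const_sqrt mult_ac)
    moreover have "r w False j = fps_const (sqrt (s j)) * (case w of [] \<Rightarrow> 0 | x # v \<Rightarrow> if x = (False, j) then r v False (Suc j) else 0)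
        + F j * r w True j"
    proof (cases w)
      case Nil
      then show ?thesis by (simp add: r_def)
    next
      case (Cons x v)
      obtain b i where x: "x = (b, i)" by (cases x)
      let ?c = "fps_const (sqrt (s j))"
      let ?h = "stack_series p s F B g v False (Suc j)"
      have "?c * g j * ?h = ?c * ?h + F j * (?c * B j * g j * ?h)"
        by (subst g) (use that in \<open>simp_all add: algebra_simps\<close>)
      then show ?thesis
        using that by (auto simp: Cons x r_def mult_ac)
    qed
    ultimately show ?thesis by simp
  qed
  have turn: "r w False p = r w True p" for w
    using p by (cases w) (auto simp: r_def F_def)
  have close: "r w True 0 = (if w = [] then 1 else 0) + fps_X * r w False 0" for w
    using g[of 0] by (cases w) (auto simp: r_def B_def mult_ac)

  have forward: "forward s j (\<lambda>w. fps_nth (r w True 0) k) = (\<lambda>w. fps_nth (r w True j) k)" if "j \<le> p" for j k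
    using that
  proof (induction j)
    case (Suc j)
    then show ?case
      by (auto simp: fun_eq_iff hop_def push_def pop_def up split: list.splits)
  qed simp
  have backward: "backward s j (\<lambda>w. fps_nth (r w False j) k) = (\<lambda>w. fps_nth (r w False 0) k)" if "j \<le> p" for j k
    using that
  proof (induction j)
    case (Suc j)
    have "hop (False, j) (True, j) (sqrt (s j)) (sqrt (s (Suc j))) (\<lambda>w. fps_nth (r w False (Suc j)) k) = (\<lambda>w. fps_nth (r w False j) k)"
      using Suc.prems by (auto simp: fun_eq_iff hop_def push_def pop_def down split: list.splits)
    then show ?case
      using Suc by simp
  qed simp
  have "((\<lambda>u. backward s p (forward s p u)) ^^ k) vacuum = (\<lambda>w. fps_nth (r w True 0) k)"
  proof (induction k)
    case 0
    show ?case by (auto simp: close vacuum_def fun_eq_iff)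
  next
    case (Suc k)
    have "((\<lambda>u. backward s p (forward s p u)) ^^ Suc k) vacuum = backward s p (forward s p (\<lambda>w. fps_nth (r w True 0) k))"
      by (simp add: Suc)
    also have "\<dots> = (\<lambda>w. fps_nth (r w False 0) k)"
      by (simp add: forward backward flip: turn)
    also have "\<dots> = (\<lambda>w. fps_nth (r w True 0) (Suc k))"
      by (auto simp: close fun_eq_iff)
    finally show ?case .
  qed
  moreover have "r [] True 0 = 1 + fps_const (1 / s 0) * M"
    using s[of 0] by (simp add: r_def g_def Q_def distrib_left)
  ultimately show ?thesis by simp
qed

text \<open>The functional equation treats \<open>t\<^sub>0 = 1\<close> and \<open>t\<^sub>1, \<dots>, t\<^sub>p\<close> alike. They serve as the squared amplitudes \<open>s\<^sub>0, \<dots>, s\<^sub>p\<close>.\<close>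

theorem mp_series_moment_measure:
  fixes t :: "nat \<Rightarrow> real"
  assumes p: "p \<ge> 1" and t: "\<And>i. i \<in> {1..p} \<Longrightarrow> t i > 0"
  obtains M where "compact_nonneg_prob M" "\<And>k. moment k M = fps_nth (1 + mp_series p t) k"
proof -
  define s where "s i = (if i = 0 then 1 else t i)" for i
  have "(\<Prod>i=0..p. fps_const (s i) + mp_series p t) = (1 + mp_series p t) * (\<Prod>i=1..p. fps_const (t i) + mp_series p t)"
    by (simp add: s_def prod.atLeast_Suc_atMost)
  moreover have "t i \<noteq> 0" if "i \<in> {1..p}" for i
    using t[OF that] by simp
  ultimately have fix_s: "mp_series p t = fps_X * (\<Prod>i=0..p. fps_const (s i) + mp_series p t)"
    using mp_series_fixpoint[of p t] by simp
  have s: "s i > 0" if "i \<le> p" for i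
    using t[of i] that by (auto simp: s_def)
  have "s 0 = 1"
    by (simp add: s_def)
  obtain M where "compact_nonneg_prob M" "\<And>k. moment k M = (((\<lambda>u. backward s p (forward s p u)) ^^ k) vacuum) []"
    using forward_backward_moments by blast
  with fock_moments[OF p s fix_s] show thesis
    by (intro that[of M]) (simp_all add: \<open>s 0 = 1\<close>)
qed

section \<open>Free multiplicative convolution of Marchenko-Pastur laws\<close>

lemma of_real_mp_series_nth:
  fixes t :: "nat \<Rightarrow> real"
  assumes "\<And>i. i \<in> {1..p} \<Longrightarrow> t i > 0"
  shows "complex_of_real (fps_nth (1 + mp_series p t) k) = fps_nth (1 + mp_series p (\<lambda>i. complex_of_real (t i))) k"
proof (cases "k = 0")
  case True
  have "t i \<noteq> 0" if "i \<in> {1..p}" for i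
    using assms[OF that] by simp
  then have "fps_nth (mp_series p t) 0 = 0" "fps_nth (mp_series p (\<lambda>i. complex_of_real (t i))) 0 = 0"
    by (auto intro!: mp_series_nth_0)
  then show ?thesis
    using True by simp
next
  case False
  then show ?thesis
    using mp_series_nth[of k p t, where ?'a = real] mp_series_nth[of k p t, where ?'a = complex] assms by simp
qed

definition mp_product_law :: "nat \<Rightarrow> (nat \<Rightarrow> real) \<Rightarrow> real measure \<Rightarrow> bool" where
  "mp_product_law p t \<mu> \<longleftrightarrow> compact_nonneg_prob \<mu> \<and> (\<forall>k. moment k \<mu> = fps_nth (1 + mp_series p t) k)"

text \<open>Let \<open>w\<close> be the generating function with all \<open>q + 1\<close> parameters and \<open>c = t\<^sub>q\<^sub>+\<^sub>1\<close>. Its functional equation can be read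
as the one with \<open>q\<close> parameters, with \<open>z\<close> replaced by \<open>u = z (c + w)\<close>, and also as the one of a single
Marchenko-Pastur law, with \<open>z\<close> replaced by \<open>v = w / ((1 + w) (c + w))\<close>. These are the arguments for which both
resolvents have expectation \<open>1 + w\<close>, and \<open>u v (1 + w) = z w\<close>.\<close>

lemma free_product_mp_moments:
  fixes t :: "nat \<Rightarrow> complex"
  assumes \<phi>: "nc_poly.unital_functional \<phi>" "nc_poly.free_vars \<phi> x I" and ij: "i \<in> I" "j \<in> I" "i \<noteq> j"
    and t: "\<And>l. l \<in> {1..Suc q} \<Longrightarrow> t l \<noteq> 0"
    and law_i: "\<And>n. \<phi> (x i ^ n) = fps_nth (1 + mp_series q t) n"
    and law_j: "\<And>n. \<phi> (x j ^ n) = fps_nth (1 + mp_series 1 (\<lambda>_. t (Suc q))) n"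
  shows "\<phi> ((x i * x j) ^ n) = fps_nth (1 + mp_series (Suc q) t) n"
proof -
  define w where "w = mp_series (Suc q) t"
  define c where "c = t (Suc q)"
  define u where "u = fps_X * (fps_const c + w)"
  define v where "v = w * inverse ((1 + w) * (fps_const c + w))"
  have c: "c \<noteq> 0" using t by (simp add: c_def)
  have w0: "fps_nth w 0 = 0"
    unfolding w_def using t by (rule mp_series_nth_0)
  have w_fix: "w = fps_X * ((1 + w) * (\<Prod>l=1..Suc q. fps_const (t l) + w))"
    unfolding w_def using t by (rule mp_series_fixpoint)
  have unit: "inverse ((1 + w) * (fps_const c + w)) * ((1 + w) * (fps_const c + w)) = 1"
    using w0 c by (intro inverse_mult_eq_1) simp
  have "w = lagrange_series (mp_symbol q t) oo u"
  proof (rule lagrange_series_unique)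
    show "w = u * (mp_symbol q t oo w)"
      using w_fix unfolding mp_symbol_compose[OF w0] u_def c_def
      by (simp add: prod.nat_ivl_Suc' mult_ac)
  qed (use t w0 in \<open>simp_all add: mp_symbol_nth_0\<close>)
  moreover have "Abs_fps (\<lambda>n. \<phi> (x i ^ n)) = 1 + lagrange_series (mp_symbol q t)"
    by (simp add: fps_eq_iff law_i mp_series_def)
  ultimately have i: "Abs_fps (\<lambda>n. \<phi> (x i ^ n)) oo u = 1 + w"
    by (simp add: fps_compose_add_distrib)
  have "w = lagrange_series (mp_symbol 1 (\<lambda>_. c)) oo v"
  proof (rule lagrange_series_unique)
    show "w = v * (mp_symbol 1 (\<lambda>_. c) oo w)"
      using unit unfolding mp_symbol_compose[OF w0] v_def by (simp add: mult.assoc)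
  qed (use c w0 in \<open>simp_all add: mp_symbol_nth_0\<close>)
  moreover have "Abs_fps (\<lambda>n. \<phi> (x j ^ n)) = 1 + lagrange_series (mp_symbol 1 (\<lambda>_. c))"
    by (simp add: fps_eq_iff law_j mp_series_def c_def)
  ultimately have j: "Abs_fps (\<lambda>n. \<phi> (x j ^ n)) oo v = 1 + w"
    by (simp add: fps_compose_add_distrib)
  have "fps_nth w 1 \<noteq> 0"
  proof -
    have "fps_nth (mp_symbol (Suc q) t) 0 \<noteq> 0"
      using t by (simp add: mp_symbol_nth_0)
    from lagrange_inversion[OF this, of 1] this show ?thesis
      by (simp add: w_def mp_series_def)
  qed
  moreover have "u * v * (1 + w) = fps_X * w"
  proof -
    have "u * v * (1 + w) = fps_X * w * (inverse ((1 + w) * (fps_const c + w)) * ((1 + w) * (fps_const c + w)))"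
      by (simp only: u_def v_def mult_ac)
    then show ?thesis by (simp only: unit mult_1_right)
  qed
  moreover have "fps_nth u 0 = 0" "fps_nth v 0 = 0"
    by (simp_all add: u_def v_def w0)
  ultimately have "Abs_fps (\<lambda>n. \<phi> ((x i * x j) ^ n)) = 1 + w"
    using i j w0 by (intro nc_poly.free_product_moment_series[OF \<phi> ij])
  then show ?thesis
    unfolding w_def by (metis fps_nth_Abs_fps)
qed

text \<open>Any functional that makes the indeterminates free with the given laws yields the same moments of the
product. Those are the moments of one and only one compactly supported law, so the definite description
in the definition of the convolution is satisfied exactly by this law.\<close>

lemma mp_product_law_free_mult_conv:
  assumes t: "\<And>i. i \<in> {1..Suc q} \<Longrightarrow> t i > 0" and \<mu>: "mp_product_law q t \<mu>"
  shows "mp_product_law (Suc q) t (\<mu> \<boxtimes> marchenko_pastur (t (Suc q)))"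
proof -
  let ?\<nu> = "marchenko_pastur (t (Suc q))"
  let ?is_conv = "\<lambda>\<kappa>. compact_nonneg_prob \<kappa> \<and>
     (\<exists>\<phi> :: bool nc_poly \<Rightarrow> complex.
        nc_poly.unital_functional \<phi> \<and> nc_poly.free_vars \<phi> nc_var UNIV \<and>
        has_law \<phi> (nc_var False) \<mu> \<and> has_law \<phi> (nc_var True) ?\<nu> \<and>
        has_law \<phi> (nc_var False * nc_var True) \<kappa>)"
  have tpos: "t (Suc q) > 0" using t by simp
  have \<nu>: "moment n ?\<nu> = fps_nth (1 + mp_series 1 (\<lambda>_. t (Suc q))) n" for n
    by (rule marchenko_pastur_moments(2)[OF tpos])
  have product_moments: "\<phi> ((nc_var False * nc_var True) ^ n) = complex_of_real (fps_nth (1 + mp_series (Suc q) t) n)"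
    if \<phi>: "nc_poly.unital_functional \<phi>" "nc_poly.free_vars \<phi> nc_var UNIV"
      and laws: "has_law \<phi> (nc_var False) \<mu>" "has_law \<phi> (nc_var True) ?\<nu>" for \<phi> :: "bool nc_poly \<Rightarrow> complex" and n
  proof -
    have "\<phi> ((nc_var False * nc_var True) ^ n) = fps_nth (1 + mp_series (Suc q) (\<lambda>i. complex_of_real (t i))) n"
    proof (rule free_product_mp_moments[OF \<phi>])
      show "complex_of_real (t l) \<noteq> 0" if "l \<in> {1..Suc q}" for l
        using t[OF that] by simp
      show "\<phi> (nc_var False ^ n) = fps_nth (1 + mp_series q (\<lambda>i. complex_of_real (t i))) n" for n
      proof -
        have "\<phi> (nc_var False ^ n) = complex_of_real (fps_nth (1 + mp_series q t) n)"
          using laws(1) \<mu> unfolding has_law_def mp_product_law_def by metis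
        also have "\<dots> = fps_nth (1 + mp_series q (\<lambda>i. complex_of_real (t i))) n"
          using t by (intro of_real_mp_series_nth) auto
        finally show ?thesis .
      qed
      show "\<phi> (nc_var True ^ n) = fps_nth (1 + mp_series 1 (\<lambda>_. complex_of_real (t (Suc q)))) n" for n
        using laws(2) \<nu> tpos of_real_mp_series_nth[of 1 "\<lambda>_. t (Suc q)" n] by (simp add: has_law_def)
    qed auto
    then show ?thesis
      using t by (simp only: of_real_mp_series_nth)
  qed
  obtain \<kappa> where \<kappa>: "compact_nonneg_prob \<kappa>" "\<And>k. moment k \<kappa> = fps_nth (1 + mp_series (Suc q) t) k"
    using mp_series_moment_measure[of "Suc q" t] t by auto
  have "?is_conv \<kappa>"
  proof (intro conjI exI)
    let ?m = "\<lambda>b n. complex_of_real (moment n (if b then ?\<nu> else \<mu>))"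
    have mass: "moment 0 \<rho> = 1" if "compact_nonneg_prob \<rho>" for \<rho>
      using that by (simp add: moment_def compact_nonneg_prob_def prob_space.prob_space)
    have "?m b 0 = 1" for b
      using mass[of \<mu>] mass[of ?\<nu>] \<mu> marchenko_pastur_moments(1)[OF tpos] by (simp add: mp_product_law_def)
    note \<phi> = free_functional[of ?m, OF this]
    show "nc_poly.unital_functional (free_functional ?m)" "nc_poly.free_vars (free_functional ?m) nc_var UNIV"
      by (rule \<phi>)+
    show laws: "has_law (free_functional ?m) (nc_var False) \<mu>" "has_law (free_functional ?m) (nc_var True) ?\<nu>"
      by (simp_all add: has_law_def \<phi>(3))
    show "has_law (free_functional ?m) (nc_var False * nc_var True) \<kappa>"
      unfolding has_law_def using product_moments[OF \<phi>(1,2) laws] \<kappa>(2) by simp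
  qed (rule \<kappa>)
  moreover have "\<kappa>' = \<kappa>" if conv: "?is_conv \<kappa>'" for \<kappa>'
  proof (rule compact_nonneg_prob_determined_by_moments)
    fix n
    obtain \<phi> :: "bool nc_poly \<Rightarrow> complex" where \<phi>: "nc_poly.unital_functional \<phi>" "nc_poly.free_vars \<phi> nc_var UNIV"
      "has_law \<phi> (nc_var False) \<mu>" "has_law \<phi> (nc_var True) ?\<nu>" "has_law \<phi> (nc_var False * nc_var True) \<kappa>'"
      using conv by blast
    have "complex_of_real (moment n \<kappa>') = complex_of_real (moment n \<kappa>)"
      using product_moments[OF \<phi>(1-4), of n] \<phi>(5) \<kappa>(2) by (simp add: has_law_def)
    then show "moment n \<kappa>' = moment n \<kappa>" by simp
  qed (use conv \<kappa> in auto)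
  ultimately have "\<mu> \<boxtimes> ?\<nu> = \<kappa>"
    unfolding free_mult_conv_def by (rule the_equality)
  then show ?thesis
    using \<kappa> by (simp add: mp_product_law_def)
qed

theorem proposition4p1:
  fixes p k :: nat and t :: "nat \<Rightarrow> real"
  assumes "p \<ge> 1" and "k \<ge> 1" and "\<And>i. i \<in> {1..p} \<Longrightarrow> t i > 0"
  shows "moment k (foldl (\<boxtimes>) (marchenko_pastur (t 1)) (map (\<lambda>i. marchenko_pastur (t i)) [2..<Suc p]))
           = fuss_narayana p k t"
proof -
  have "mp_product_law p t (foldl (\<boxtimes>) (marchenko_pastur (t 1)) (map (\<lambda>i. marchenko_pastur (t i)) [2..<Suc p]))"
    using assms(1,3)
  proof (induction p rule: dec_induct)
    case base
    have "mp_series 1 t = mp_series 1 (\<lambda>_. t 1)"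
      by (simp add: mp_series_def mp_symbol_def)
    then show ?case
      using marchenko_pastur_moments[of "t 1"] base by (simp add: mp_product_law_def)
  next
    case (step q)
    then have "[2..<Suc (Suc q)] = [2..<Suc q] @ [Suc q]" by simp
    then show ?case
      using mp_product_law_free_mult_conv[of q t] step by simp
  qed
  then have "moment k (foldl (\<boxtimes>) (marchenko_pastur (t 1)) (map (\<lambda>i. marchenko_pastur (t i)) [2..<Suc p])) = fps_nth (mp_series p t) k"
    using assms(2) by (simp add: mp_product_law_def)
  also have "\<dots> = fuss_narayana p k t"
    using mp_series_nth[OF assms(2), of p t, where ?'a = real] assms(3) by simp
  finally show ?thesis .
qed

end
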